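(* Let $k\ge1$, $\varepsilon>0$. There exists $\mathsf h_1\in\mathcal H$ such that for every $p\in[\varepsilon,1-\varepsilon]$ and all integers $n\ge m\ge 3$, $$\mathbf P_p\big[\Gamma_1\overset{R}{\longleftrightarrow}\Gamma_2\big]\ge \mathsf h_1\big(f_p(3n,2m)\,a(m,n)^2\big),$$ where $R=\overline{[0,3n]\times[-m,m]}$, $\Gamma_1$ is the minimal open circuit in $\overline{A_{m,n}}$ surrounding $\overline{B_m}$ ($\Gamma_1=\emptyset$ if there is none), $\Gamma_2$ is the minimal open circuit in $\overline{A_{m,n}((3n,0))}$ surrounding $\overline{B_m((3n,0))}$ ($\emptyset$ if none), and $a(m,n)=\mathbf P_p[\Gamma_1\ne\emptyset]$.
   Context: $\mathbb S_k=\mathbb Z^2\times\{0,\dots,k\}$ with nearest-neighbour edges; $\mathbf P_p$ is Bernoulli bond percolation. For $T\subset\mathbb Z^2$, $\overline T=T\times\{0,\dots,k\}$; $B_n(x)=x+[-n,n]^2$, $B_n=B_n(0)$, $A_{n,m}(x)=B_m(x)\setminus B_n(x)$, $A_{n,m}=A_{n,m}(0)$. $f_p(m,n)$ is the probability of an open path inside $\overline{[0,m]\times[0,n]}$ from $\overline{\{0\}\times[0,n]}$ to $\overline{\{m\}\times[0,n]}$. $X\overset{R}{\longleftrightarrow}Y$ is the event that there is an open path inside $R$ from $X\cap R$ to $Y\cap R$ (it fails if $X$ or $Y$ is empty). $\mathcal H$ is the set of continuous strictly increasing functions $[0,1]\to[0,1]$. A circuit is a path $(\Gamma(i))_{i=1}^{r}$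 with $\Gamma(1)=\Gamma(r)$ and $(\Gamma(i))_{i=1}^{r-1}$ self-avoiding; it is open if all its edges are open; it surrounds $\overline{B_m(x)}$ if its projection onto $\mathbb Z^2$ has nonzero winding number around $x$. Vertex order: $x\prec y$ iff $|x|<|y|$ or ($|x|=|y|$ and $x$ is lexicographically smaller). Circuits are identified up to cyclic permutation and reversal; the representative is chosen with $\Gamma(1)\prec\Gamma(i)$ for $i>1$ and $\Gamma(2)\prec\Gamma(r-1)$, and circuits are ordered lexicographically by these representative vertex sequences; "minimal" refers to this order. *)

theory Defs
  imports "HOL-Probability.Probability"
begin

type_synonym vtx = "int \<times> int \<times> int"
type_synonym edge = "vtx set"
type_synonym config = "edge \<Rightarrow> bool"

definition slab :: "nat \<Rightarrow> vtx set" where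
  "slab k = {(a,b,c). 0 \<le> c \<and> c \<le> int k}"

definition adj :: "vtx \<Rightarrow> vtx \<Rightarrow> bool" where
  "adj x y \<longleftrightarrow> (case x of (a,b,c) \<Rightarrow> case y of (a',b',c') \<Rightarrow>
      \<bar>a - a'\<bar> + \<bar>b - b'\<bar> + \<bar>c - c'\<bar> = 1)"

definition edges :: "nat \<Rightarrow> edge set" where
  "edges k = {{x,y} | x y. x \<in> slab k \<and> y \<in> slab k \<and> adj x y}"

text \<open>Bernoulli bond percolation with parameter p on S_k (True = open).\<close>
definition Pperc :: "nat \<Rightarrow> real \<Rightarrow> config measure" where
  "Pperc k p = (\<Pi>\<^sub>M e\<in>edges k. measure_pmf (bernoulli_pmf p))"

definition Pr :: "nat \<Rightarrow> real \<Rightarrow> (config \<Rightarrow> bool) \<Rightarrow> real" where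
  "Pr k p A = measure (Pperc k p) {\<omega> \<in> space (Pperc k p). A \<omega>}"

definition ovl :: "nat \<Rightarrow> (int \<times> int) set \<Rightarrow> vtx set" where
  "ovl k T = {(a,b,c). (a,b) \<in> T \<and> 0 \<le> c \<and> c \<le> int k}"

definition Box :: "int \<Rightarrow> int \<times> int \<Rightarrow> (int \<times> int) set" where
  "Box n x = {y. \<bar>fst y - fst x\<bar> \<le> n \<and> \<bar>snd y - snd x\<bar> \<le> n}"

definition Ann :: "int \<Rightarrow> int \<Rightarrow> int \<times> int \<Rightarrow> (int \<times> int) set" where
  "Ann n m x = Box m x - Box n x"

definition rect :: "int \<Rightarrow> int \<Rightarrow> int \<Rightarrow> int \<Rightarrow> (int \<times> int) set" where
  "rect a1 a2 b1 b2 = {a1..a2} \<times> {b1..b2}"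

definition connects :: "nat \<Rightarrow> config \<Rightarrow> vtx set \<Rightarrow> vtx set \<Rightarrow> vtx set \<Rightarrow> bool" where
  "connects k \<omega> R X Y \<longleftrightarrow> (\<exists>ps. ps \<noteq> [] \<and> set ps \<subseteq> R \<and> set ps \<subseteq> slab k \<and>
      hd ps \<in> X \<and> last ps \<in> Y \<and>
      (\<forall>i < length ps - 1. adj (ps ! i) (ps ! (i+1)) \<and> \<omega> {ps ! i, ps ! (i+1)}))"

definition crossing_prob :: "nat \<Rightarrow> real \<Rightarrow> int \<Rightarrow> int \<Rightarrow> real" where
  "crossing_prob k p m n = Pr k p (\<lambda>\<omega>. connects k \<omega> (ovl k (rect 0 m 0 n))
       (ovl k (rect 0 0 0 n)) (ovl k (rect m m 0 n)))"

definition classH :: "(real \<Rightarrow> real) \<Rightarrow> bool" where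
  "classH h \<longleftrightarrow> continuous_on {0..1} h \<and> strict_mono_on {0..1} h \<and> h ` {0..1} \<subseteq> {0..1}"

definition is_circuit :: "nat \<Rightarrow> vtx list \<Rightarrow> bool" where
  "is_circuit k c \<longleftrightarrow> length c \<ge> 2 \<and> c ! 0 = c ! (length c - 1) \<and> distinct (butlast c) \<and>
      set c \<subseteq> slab k \<and> (\<forall>i < length c - 1. adj (c ! i) (c ! (i+1)))"

definition open_circuit :: "config \<Rightarrow> vtx list \<Rightarrow> bool" where
  "open_circuit \<omega> c \<longleftrightarrow> (\<forall>i < length c - 1. \<omega> {c ! i, c ! (i+1)})"

definition proj :: "vtx \<Rightarrow> int \<times> int" where
  "proj v = (fst v, fst (snd v))"

definition cpt :: "int \<times> int \<Rightarrow> complex" where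
  "cpt z = Complex (of_int (fst z)) (of_int (snd z))"

definition winding :: "vtx list \<Rightarrow> int \<times> int \<Rightarrow> real" where
  "winding c x = (\<Sum>i < length c - 1.
      Arg ((cpt (proj (c ! (i+1))) - cpt x) / (cpt (proj (c ! i)) - cpt x))) / (2 * pi)"

definition surrounds :: "vtx list \<Rightarrow> int \<times> int \<Rightarrow> bool" where
  "surrounds c x \<longleftrightarrow> winding c x \<noteq> 0"

definition nrm2 :: "vtx \<Rightarrow> int" where
  "nrm2 v = (case v of (a,b,c) \<Rightarrow> a*a + b*b + c*c)"

definition lexlt3 :: "vtx \<Rightarrow> vtx \<Rightarrow> bool" where
  "lexlt3 x y \<longleftrightarrow> (case x of (a,b,c) \<Rightarrow> case y of (a',b',c') \<Rightarrow>
      a < a' \<or> (a = a' \<and> (b < b' \<or> (b = b' \<and> c < c'))))"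

definition vprec :: "vtx \<Rightarrow> vtx \<Rightarrow> bool" where
  "vprec x y \<longleftrightarrow> nrm2 x < nrm2 y \<or> (nrm2 x = nrm2 y \<and> lexlt3 x y)"

definition normalized :: "vtx list \<Rightarrow> bool" where
  "normalized c \<longleftrightarrow> (\<forall>i. 0 < i \<and> i < length c - 1 \<longrightarrow> vprec (c ! 0) (c ! i)) \<and>
      vprec (c ! 1) (c ! (length c - 2))"

definition circ_lex :: "(vtx list \<times> vtx list) set" where
  "circ_lex = lexord {(x,y). vprec x y}"

definition circ_set :: "nat \<Rightarrow> config \<Rightarrow> int \<Rightarrow> int \<Rightarrow> int \<times> int \<Rightarrow> vtx list set" where
  "circ_set k \<omega> m n x = {c. is_circuit k c \<and> normalized c \<and> open_circuit \<omega> c \<and>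
      set c \<subseteq> ovl k (Ann m n x) \<and> surrounds c x}"

definition min_circuit :: "nat \<Rightarrow> config \<Rightarrow> int \<Rightarrow> int \<Rightarrow> int \<times> int \<Rightarrow> vtx set" where
  "min_circuit k \<omega> m n x = (if circ_set k \<omega> m n x = {} then {}
     else set (THE c. c \<in> circ_set k \<omega> m n x \<and>
        (\<forall>c' \<in> circ_set k \<omega> m n x. c' \<noteq> c \<longrightarrow> (c, c') \<in> circ_lex)))"

end

theory Submission
  imports Defs
begin

text \<open>
  By Harris' inequality and translation invariance, with probability at least
  $f_p(3n,2m)\,a(m,n)^2$ the strip $R$ is crossed from left to right and both circuits exist.
  The two circuits are then connected to the crossing one after the other, each time by a map on
  configurations that is bounded-to-one and changes only the edges touching one column; this
  loses a constant factor, so $h_1$ can be taken linear.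

  Let $c$ be the minimal circuit, not connected in $R$ to the target $T$, and let $\pi$ be the
  lexicographically least self-avoiding open path in $R$ from $T$ to a set $L$ inside $c$. By a
  winding number argument $\pi$ and $c$ meet in some column, and the surgery opens a vertical
  segment from a point $u$ of $\pi$ to a point $v$ of $c$. The difficulty is to recover the column,
  since $c$ may be connected to $T$ outside $R$ and the minimal circuit may change. If the new edge
  ranks after the edge by which $\pi$ leaves $u$, then $\pi$ is still the least path afterwards, so
  it is known from the image. Two preimages with different columns, circuits $c_1,c_2$ and bridges
  $e_1,e_2$, then contradict each other: if $c_1$ uses $e_2$, it is connected to
  $\pi$ already before the surgery; if neither circuit uses the other bridge, minimality
  gives $c_1=c_2$, and $e_1$ connects this circuit to $\pi$ in the second preimage. The ranking
  condition is obtained for at least half of all choices of an orientation bit at every vertex.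
\<close>

section \<open>Bernoulli measures on finite sets of edges\<close>

text \<open>The least path is endangered only at \<open>u\<close>. If it leaves \<open>u\<close>
  horizontally, ranking horizontal steps before vertical ones protects it from the vertical bridge.
  If it leaves vertically, it moves away from the bridge, and any fixed preference between up and
  down fails for one of the two directions. With a free bit per vertex, flipping the bit at
  \<open>u\<close> repairs the rank without changing the least path, hence without changing
  \<open>u\<close>; so flipping injects the failing bit sets into the successful ones. The bits are
  no part of the percolation, and averaging over them costs a factor 2.

  The bridge joins a point of the path to a point of the circuit with no other point of either
  between them. All edges at its interior vertices are closed before it is opened: this harms
  neither path nor circuit and leaves \<open>u\<close> as the only bridge vertex in the cluster of
  the target.

  A column has \<open>k + 1\<close> vertices of degree at most 6, so one gluing loses at most
  \<open>1 + 2 * (2 / \<epsilon>) ^ (6 * (k + 1))\<close>, where the 1 stands for configurations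
  that are already connected; two gluings square this.\<close>

definition wt :: "real \<Rightarrow> 'e set \<Rightarrow> 'e set \<Rightarrow> real" where
  "wt p F S = (\<Prod>e\<in>F. if e \<in> S then p else 1 - p)"

text \<open>On a finite edge set a configuration is the set \<open>S\<close> of its open edges:
  events are predicates on sets, increasing events are the \<open>mono\<close> ones, and
  probabilities are finite sums.\<close>

definition bern :: "real \<Rightarrow> 'e set \<Rightarrow> ('e set \<Rightarrow> bool) \<Rightarrow> real" where
  "bern p F A = (\<Sum>S\<in>Pow F. wt p F S * of_bool (A S))"

lemma wt_nonneg: "0 \<le> p \<Longrightarrow> p \<le> 1 \<Longrightarrow> 0 \<le> wt p F S"
  unfolding wt_def by (intro prod_nonneg) auto

lemma sum_Pow_insert:
  fixes g :: "'e set \<Rightarrow> real"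
  assumes "finite F" "x \<notin> F"
  shows "(\<Sum>S\<in>Pow (insert x F). g S) = (\<Sum>S\<in>Pow F. g S + g (insert x S))"
proof -
  have inj: "inj_on (insert x) (Pow F)"
    using assms(2) by (intro inj_onI) (metis PowD insert_ident subsetD)
  have "(\<Sum>S\<in>Pow (insert x F). g S) = (\<Sum>S\<in>Pow F. g S) + (\<Sum>S\<in>insert x ` Pow F. g S)"
    unfolding Pow_insert by (rule sum.union_disjoint) (use assms in auto)
  then show ?thesis
    by (simp add: sum.reindex[OF inj] sum.distrib)
qed

lemma wt_insert:
  assumes "finite F" "x \<notin> F" "S \<subseteq> F"
  shows "wt p (insert x F) S = (1 - p) * wt p F S"
    and "wt p (insert x F) (insert x S) = p * wt p F S"
proof -
  show "wt p (insert x F) S = (1 - p) * wt p F S"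
    using assms unfolding wt_def by auto
  have "(\<Prod>e\<in>F. if e \<in> insert x S then p else 1 - p) = (\<Prod>e\<in>F. if e \<in> S then p else 1 - p)"
    using assms by (intro prod.cong) auto
  then show "wt p (insert x F) (insert x S) = p * wt p F S"
    using assms unfolding wt_def by simp
qed

lemma sum_wt_insert:
  assumes "finite F" "x \<notin> F"
  shows "(\<Sum>S\<in>Pow (insert x F). wt p (insert x F) S * g S)
    = (1 - p) * (\<Sum>S\<in>Pow F. wt p F S * g S) + p * (\<Sum>S\<in>Pow F. wt p F S * g (insert x S))"
  using assms by (simp add: sum_Pow_insert wt_insert sum.distrib sum_distrib_left mult.assoc)

lemma bern_mono:
  assumes "0 \<le> p" "p \<le> 1" "\<And>S. S \<subseteq> F \<Longrightarrow> A S \<Longrightarrow> B S"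
  shows "bern p F A \<le> bern p F B"
  unfolding bern_def using assms by (intro sum_mono mult_left_mono wt_nonneg) auto

lemma bern_nonneg: "0 \<le> p \<Longrightarrow> p \<le> 1 \<Longrightarrow> 0 \<le> bern p F A"
  unfolding bern_def by (intro sum_nonneg mult_nonneg_nonneg wt_nonneg) auto

lemma bern_disj_le:
  assumes "0 \<le> p" "p \<le> 1"
  shows "bern p F (\<lambda>S. A S \<or> B S) \<le> bern p F A + bern p F B"
  unfolding bern_def sum.distrib[symmetric]
proof (rule sum_mono)
  fix S
  have "wt p F S * of_bool (A S \<or> B S) \<le> wt p F S * (of_bool (A S) + of_bool (B S))"
    by (intro mult_left_mono wt_nonneg assms) auto
  then show "wt p F S * of_bool (A S \<or> B S) \<le> wt p F S * of_bool (A S) + wt p F S * of_bool (B S)"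
    by (simp add: distrib_left)
qed

lemma bern_image:
  assumes "inj t"
  shows "bern p (t ` F) A = bern p F (\<lambda>S. A (t ` S))"
proof -
  have inj: "inj_on t F" using assms by (rule inj_on_subset) auto
  have "wt p (t ` F) (t ` S) = wt p F S" for S
    unfolding wt_def by (simp add: prod.reindex[OF inj] inj_image_mem_iff[OF assms])
  moreover have "inj_on ((`) t) (Pow F)"
    by (rule inj_on_image_Pow[OF inj])
  ultimately show ?thesis
    unfolding bern_def image_Pow_surj[OF refl, of t F, symmetric] by (simp add: sum.reindex)
qed

text \<open>Induction on the edges. With the state of \<open>x\<close> fixed the induction
  hypothesis applies; opening \<open>x\<close> raises both conditional means, so these are
  positively correlated (Chebyshev's inequality on two points).\<close>

lemma harris_functions:
  fixes f g :: "'e set \<Rightarrow> real"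
  assumes "finite F" "0 \<le> p" "p \<le> 1" "mono f" "mono g"
  shows "(\<Sum>S\<in>Pow F. wt p F S * f S) * (\<Sum>S\<in>Pow F. wt p F S * g S)
    \<le> (\<Sum>S\<in>Pow F. wt p F S * (f S * g S))"
  using assms(1,4,5)
proof (induction F arbitrary: f g rule: finite_induct)
  case empty
  then show ?case by (simp add: wt_def)
next
  case (insert x F)
  define E where "E h = (\<Sum>S\<in>Pow F. wt p F S * h S)" for h :: "'e set \<Rightarrow> real"
  let ?f1 = "\<lambda>S. f (insert x S)" and ?g1 = "\<lambda>S. g (insert x S)"
  have m: "mono ?f1" "mono ?g1"
    by (rule monoI, rule monoD[OF insert.prems(1)], blast, rule monoI, rule monoD[OF insert.prems(2)], blast)
  have Emono: "E h \<le> E h'" if "\<And>S. h S \<le> h' S" for h h'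
    unfolding E_def by (intro sum_mono mult_left_mono wt_nonneg assms that)
  have "E f \<le> E ?f1" "E g \<le> E ?g1"
    by (intro Emono monoD[OF insert.prems(1)] monoD[OF insert.prems(2)]; blast)+
  then have "0 \<le> p * (1 - p) * ((E ?f1 - E f) * (E ?g1 - E g))"
    using assms(2,3) by simp
  \<comment> \<open>The subtracted term is the covariance of the two conditional means as functions
    of the state of \<open>x\<close>.\<close>
  moreover have "((1 - p) * E f + p * E ?f1) * ((1 - p) * E g + p * E ?g1)
      = (1 - p) * (E f * E g) + p * (E ?f1 * E ?g1)
        - p * (1 - p) * ((E ?f1 - E f) * (E ?g1 - E g))"
    by algebra
  moreover have "(1 - p) * (E f * E g) + p * (E ?f1 * E ?g1)
      \<le> (1 - p) * E (\<lambda>S. f S * g S) + p * E (\<lambda>S. ?f1 S * ?g1 S)"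
    using insert.IH[OF insert.prems] insert.IH[OF m] assms(2,3)
    by (intro add_mono mult_left_mono) (auto simp: E_def)
  ultimately show ?case
    using insert.hyps by (simp add: sum_wt_insert E_def)
qed

lemma harris:
  assumes "finite F" "0 \<le> p" "p \<le> 1" "mono A" "mono B"
  shows "bern p F A * bern p F B \<le> bern p F (\<lambda>S. A S \<and> B S)"
proof -
  have "mono (\<lambda>S. of_bool (A S) :: real)" "mono (\<lambda>S. of_bool (B S) :: real)"
    using assms(4,5) by (auto simp: mono_def)
  from harris_functions[OF assms(1-3) this] show ?thesis
    by (simp add: bern_def of_bool_conj)
qed

text \<open>Each factor of a weight lies between \<epsilon> and 1, so changing the state of one edge
  costs at most 1/\<epsilon>; outside \<open>N\<close> the factors coincide.\<close>

lemma wt_le_of_agree: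
  assumes "finite F" "0 < \<epsilon>" "\<epsilon> \<le> p" "p \<le> 1 - \<epsilon>" "N \<subseteq> F" "S - N = S' - N"
  shows "wt p F S \<le> (1 / \<epsilon>) ^ card N * wt p F S'"
proof -
  have split: "wt p F X = wt p N X * wt p (F - N) X" for X
    unfolding wt_def using assms by (subst prod.subset_diff[of N F]) auto
  have eq: "wt p (F - N) S = wt p (F - N) S'"
    unfolding wt_def using assms(6) by (intro prod.cong) auto
  have "wt p N S \<le> (\<Prod>e\<in>N. 1)"
    unfolding wt_def using assms by (intro prod_mono) auto
  also have "\<dots> = (1 / \<epsilon>) ^ card N * \<epsilon> ^ card N"
    using assms by (simp add: power_mult_distrib[symmetric])
  also have "\<epsilon> ^ card N = (\<Prod>e\<in>N. \<epsilon>)"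
    by simp
  also have "(1 / \<epsilon>) ^ card N * \<dots> \<le> (1 / \<epsilon>) ^ card N * wt p N S'"
    unfolding wt_def using assms by (intro mult_left_mono prod_mono) auto
  finally have "wt p N S \<le> (1 / \<epsilon>) ^ card N * wt p N S'" .
  then have "wt p N S * wt p (F - N) S \<le> ((1 / \<epsilon>) ^ card N * wt p N S') * wt p (F - N) S"
    using assms by (intro mult_right_mono wt_nonneg) auto
  then show ?thesis
    unfolding split[of S] split[of S'] eq by (simp add: mult.assoc)
qed

lemma bern_eq_sum: "finite F \<Longrightarrow> bern p F A = (\<Sum>S\<in>{S \<in> Pow F. A S}. wt p F S)"
  unfolding bern_def by (intro sum.mono_neutral_cong_right) auto

text \<open>
  The set $N(S)$ of edges changed by $\Phi$ is a function of $\Phi(S)$, so fibres have at most $2^M$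
  elements.
\<close>

lemma finite_energy:
  fixes N :: "'e set \<Rightarrow> 'e set"
  assumes F: "finite F" and \<epsilon>: "0 < \<epsilon>" "\<epsilon> \<le> p" "p \<le> 1 - \<epsilon>"
    and img: "\<And>S. S \<subseteq> F \<Longrightarrow> D S \<Longrightarrow> \<Phi> S \<subseteq> F \<and> G (\<Phi> S)"
    and local: "\<And>S. S \<subseteq> F \<Longrightarrow> D S \<Longrightarrow> N S \<subseteq> F \<and> card (N S) \<le> M \<and> S - N S = \<Phi> S - N S"
    and recon: "\<And>S S'. S \<subseteq> F \<Longrightarrow> S' \<subseteq> F \<Longrightarrow> D S \<Longrightarrow> D S' \<Longrightarrow> \<Phi> S = \<Phi> S' \<Longrightarrow> N S = N S'"
  shows "bern p F D \<le> (2 / \<epsilon>) ^ M * bern p F G"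
proof -
  let ?D = "{S \<in> Pow F. D S}" and ?G = "{S \<in> Pow F. G S}"
  have \<epsilon>1: "\<epsilon> \<le> 1" using \<epsilon> by linarith
  note restr = bern_eq_sum[OF F, of p]
  have fibre: "(\<Sum>S\<in>{S\<in>?D. \<Phi> S = S'}. wt p F S) \<le> (2 / \<epsilon>) ^ M * wt p F S'" (is "sum _ ?X \<le> _") for S'
  proof (cases "?X = {}")
    case True
    then have "sum (wt p F) ?X = 0" by (simp only: sum.empty)
    then show ?thesis using \<epsilon> by (simp add: wt_nonneg)
  next
    case False
    then obtain S0 where S0: "S0 \<in> ?X" by blast
    define N0 where "N0 = N S0"
    have N: "N S = N0" if "S \<in> ?X" for S
      using recon[of S S0] that S0 by (simp add: N0_def)
    have N0: "N0 \<subseteq> F" "card N0 \<le> M" using local[of S0] S0 by (auto simp: N0_def)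
    have finN: "finite N0" using N0 F finite_subset by blast
    have "wt p F S \<le> (1 / \<epsilon>) ^ M * wt p F S'" if S: "S \<in> ?X" for S
    proof -
      have "wt p F S \<le> (1 / \<epsilon>) ^ card N0 * wt p F S'"
        using local[of S] S N[OF S] N0 by (intro wt_le_of_agree F \<epsilon>) auto
      also have "\<dots> \<le> (1 / \<epsilon>) ^ M * wt p F S'"
        using \<epsilon> \<epsilon>1 N0(2) by (intro mult_right_mono power_increasing wt_nonneg) auto
      finally show ?thesis .
    qed
    then have "sum (wt p F) ?X \<le> of_nat (card ?X) * ((1 / \<epsilon>) ^ M * wt p F S')"
      by (intro sum_bounded_above)
    also have "card ?X \<le> 2 ^ M"
    proof -
      have "inj_on (\<lambda>S. S \<inter> N0) ?X"
      proof (rule inj_onI)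
        fix A B assume A: "A \<in> ?X" and B: "B \<in> ?X" and AB: "A \<inter> N0 = B \<inter> N0"
        have "A - N0 = S' - N0" "B - N0 = S' - N0"
          using local[of A] local[of B] A B N[OF A] N[OF B] by auto
        then show "A = B" using AB by blast
      qed
      then have "card ?X \<le> card (Pow N0)"
        using finN by (intro card_inj_on_le[of "\<lambda>S. S \<inter> N0"]) auto
      also have "\<dots> \<le> 2 ^ M" using N0(2) finN by (simp add: card_Pow)
      finally show ?thesis .
    qed
    then have "real (card ?X) \<le> 2 ^ M"
      by (metis of_nat_le_iff of_nat_numeral of_nat_power)
    then have "of_nat (card ?X) * ((1 / \<epsilon>) ^ M * wt p F S') \<le> 2 ^ M * ((1 / \<epsilon>) ^ M * wt p F S')"
      using \<epsilon> by (intro mult_right_mono mult_nonneg_nonneg wt_nonneg) auto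
    finally show ?thesis by (simp add: power_divide)
  qed
  have "bern p F D = (\<Sum>S'\<in>?G. \<Sum>S\<in>{S\<in>?D. \<Phi> S = S'}. wt p F S)"
    unfolding restr using F img by (intro sum.group[symmetric]) auto
  also have "\<dots> \<le> (\<Sum>S'\<in>?G. (2 / \<epsilon>) ^ M * wt p F S')"
    by (intro sum_mono fibre)
  finally show ?thesis by (simp add: restr sum_distrib_left)
qed

text \<open>Averaging over a uniformly random \<open>r\<close>: each configuration in
  \<open>A\<close> satisfies \<open>D r\<close> with probability at least 1/2, so exchanging the
  sums bounds the probability of \<open>A\<close> by twice the mean of the probabilities of
  \<open>D r\<close>.\<close>

lemma bern_le_of_half:
  assumes F: "finite F" and p: "0 \<le> p" "p \<le> 1" and V: "finite V"
    and D: "\<And>r. r \<subseteq> V \<Longrightarrow> bern p F (D r) \<le> K"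
    and half: "\<And>S. S \<subseteq> F \<Longrightarrow> A S \<Longrightarrow> card {r \<in> Pow V. \<not> D r S} \<le> card {r \<in> Pow V. D r S}"
  shows "bern p F A \<le> 2 * K"
proof -
  have cnt: "2 ^ card V * of_bool (A S) \<le> 2 * (\<Sum>r\<in>Pow V. of_bool (D r S) :: real)" if "S \<subseteq> F" for S
  proof (cases "A S")
    case True
    have "card (Pow V) = card {r \<in> Pow V. D r S} + card {r \<in> Pow V. \<not> D r S}"
      using V by (subst card_Un_disjoint[symmetric]) (auto intro!: arg_cong[where f = card])
    then have "2 ^ card V \<le> 2 * card {r \<in> Pow V. D r S}"
      using half[OF that True] V by (simp add: card_Pow)
    then have "real (2 ^ card V) \<le> real (2 * card {r \<in> Pow V. D r S})"
      by (rule of_nat_mono)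
    moreover have "(\<Sum>r\<in>Pow V. of_bool (D r S) :: real) = real (card {r \<in> Pow V. D r S})"
      using V by (simp add: Int_def)
    ultimately show ?thesis using True by simp
  qed (simp add: sum_nonneg)
  have "2 ^ card V * bern p F A = (\<Sum>S\<in>Pow F. wt p F S * (2 ^ card V * of_bool (A S)))"
    by (simp add: bern_def sum_distrib_left mult_ac)
  also have "\<dots> \<le> (\<Sum>S\<in>Pow F. wt p F S * (2 * (\<Sum>r\<in>Pow V. of_bool (D r S))))"
    using cnt by (intro sum_mono mult_left_mono wt_nonneg p) auto
  also have "\<dots> = 2 * (\<Sum>r\<in>Pow V. bern p F (D r))"
    unfolding bern_def by (subst sum.swap) (simp add: sum_distrib_left mult_ac)
  also have "\<dots> \<le> 2 * (\<Sum>r\<in>Pow V. K)"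
    using D by (intro mult_left_mono sum_mono) auto
  finally have "2 ^ card V * bern p F A \<le> 2 ^ card V * (2 * K)"
    using V by (simp add: card_Pow)
  then show ?thesis by simp
qed

text \<open>By \<open>dep\<close> the event is a disjoint union of cylinders, one for each
  admissible \<open>S\<close>; finiteness of \<open>F\<close> gives measurability and the sum at
  once.\<close>

lemma Pr_eq_bern:
  assumes p: "0 \<le> p" "p \<le> 1" and F: "finite F" "F \<subseteq> edges k"
    and dep: "\<And>\<omega>. A \<omega> \<longleftrightarrow> A (\<lambda>e. e \<in> F \<and> \<omega> e)"
  shows "Pr k p A = bern p F (\<lambda>S. A (\<lambda>e. e \<in> S))"
proof -
  interpret product_prob_space "\<lambda>_. measure_pmf (bernoulli_pmf p)" "edges k"
    by (simp add: product_prob_space_def product_prob_space_axioms_def product_sigma_finite_def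
        prob_space_measure_pmf prob_space.finite_measure finite_measure.sigma_finite_measure
        measure_pmf.sigma_finite_measure_axioms)
  define cyl where "cyl S = {\<omega> \<in> space (Pperc k p). \<forall>e\<in>F. \<omega> e = (e \<in> S)}" for S
  have emb: "cyl S = emb (edges k) F (Pi\<^sub>E F (\<lambda>e. {e \<in> S}))" for S
    using F(2) unfolding cyl_def Pperc_def prod_emb_def by (auto simp: space_PiM Pi_iff)
  have meas: "cyl S \<in> sets (Pperc k p)" for S
    unfolding emb Pperc_def using F by (intro sets_PiM_I) auto
  have prob: "measure (Pperc k p) (cyl S) = wt p F S" for S
  proof -
    have "measure (Pperc k p) (cyl S) = (\<Prod>e\<in>F. measure (bernoulli_pmf p) {e \<in> S})"
      unfolding emb Pperc_def using F by (intro measure_PiM_emb) auto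
    also have "\<dots> = wt p F S"
      unfolding wt_def using p by (intro prod.cong) (auto simp: measure_pmf_single)
    finally show ?thesis .
  qed
  have "{\<omega> \<in> space (Pperc k p). A \<omega>} = (\<Union>S\<in>{S \<in> Pow F. A (\<lambda>e. e \<in> S)}. cyl S)"
  proof (intro set_eqI iffI)
    fix \<omega> assume \<omega>: "\<omega> \<in> {\<omega> \<in> space (Pperc k p). A \<omega>}"
    then have "A (\<lambda>e. e \<in> {e \<in> F. \<omega> e})" using dep[of \<omega>] by simp
    then show "\<omega> \<in> (\<Union>S\<in>{S \<in> Pow F. A (\<lambda>e. e \<in> S)}. cyl S)"
      using \<omega> by (intro UN_I[of "{e \<in> F. \<omega> e}"]) (auto simp: cyl_def)
  next
    fix \<omega> assume "\<omega> \<in> (\<Union>S\<in>{S \<in> Pow F. A (\<lambda>e. e \<in> S)}. cyl S)"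
    then obtain S where S: "S \<subseteq> F" "A (\<lambda>e. e \<in> S)" "\<omega> \<in> cyl S" by auto
    then have "(\<lambda>e. e \<in> F \<and> \<omega> e) = (\<lambda>e. e \<in> S)" by (auto simp: cyl_def)
    then show "\<omega> \<in> {\<omega> \<in> space (Pperc k p). A \<omega>}"
      using S dep[of \<omega>] by (simp add: cyl_def)
  qed
  then have "Pr k p A = measure (Pperc k p) (\<Union>S\<in>{S \<in> Pow F. A (\<lambda>e. e \<in> S)}. cyl S)"
    unfolding Pr_def by (rule arg_cong)
  also have "\<dots> = (\<Sum>S\<in>{S \<in> Pow F. A (\<lambda>e. e \<in> S)}. measure (Pperc k p) (cyl S))"
    unfolding Pperc_def
  proof (rule finite_measure_finite_Union)
    show "finite {S \<in> Pow F. A (\<lambda>e. e \<in> S)}" using F by simp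
    show "cyl ` {S \<in> Pow F. A (\<lambda>e. e \<in> S)} \<subseteq> P.events"
      using meas unfolding Pperc_def by blast
    show "disjoint_family_on cyl {S \<in> Pow F. A (\<lambda>e. e \<in> S)}"
      unfolding disjoint_family_on_def cyl_def by blast
  qed
  also have "\<dots> = bern p F (\<lambda>S. A (\<lambda>e. e \<in> S))"
    unfolding prob bern_eq_sum[OF F(1)] ..
  finally show ?thesis .
qed

section \<open>Walks and lexicographically least paths\<close>

definition step :: "edge set \<Rightarrow> vtx \<Rightarrow> vtx \<Rightarrow> bool" where
  "step S x y \<longleftrightarrow> adj x y \<and> {x, y} \<in> S"

definition walk :: "edge set \<Rightarrow> vtx set \<Rightarrow> vtx list \<Rightarrow> bool" where
  "walk S X ps \<longleftrightarrow> ps \<noteq> [] \<and> set ps \<subseteq> X \<and> successively (step S) ps"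

definition conn :: "edge set \<Rightarrow> vtx set \<Rightarrow> vtx set \<Rightarrow> vtx set \<Rightarrow> bool" where
  "conn S X A B \<longleftrightarrow> (\<exists>ps. walk S X ps \<and> hd ps \<in> A \<and> last ps \<in> B)"

definition reach :: "edge set \<Rightarrow> vtx set \<Rightarrow> vtx set \<Rightarrow> vtx set" where
  "reach S X A = {y. \<exists>ps. walk S X ps \<and> hd ps \<in> A \<and> last ps = y}"

lemma conn_iff_reach: "conn S X A B \<longleftrightarrow> reach S X A \<inter> B \<noteq> {}"
  unfolding conn_def reach_def by auto

lemma adj_commute: "adj x y \<longleftrightarrow> adj y x"
  unfolding adj_def by (auto simp: abs_minus_commute split: prod.splits)

lemma step_commute: "step S x y \<longleftrightarrow> step S y x"
  unfolding step_def by (simp add: adj_commute insert_commute)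

lemma step_mono: "step S x y \<Longrightarrow> S \<subseteq> S' \<Longrightarrow> step S' x y"
  unfolding step_def by blast

lemma walk_mono: "walk S X ps \<Longrightarrow> S \<subseteq> S' \<Longrightarrow> X \<subseteq> X' \<Longrightarrow> walk S' X' ps"
  unfolding walk_def by (blast intro: successively_mono step_mono)

lemma reach_mono: "S \<subseteq> S' \<Longrightarrow> X \<subseteq> X' \<Longrightarrow> A \<subseteq> A' \<Longrightarrow> reach S X A \<subseteq> reach S' X' A'"
  unfolding reach_def by (blast intro: walk_mono)

lemma reach_subset: "reach S X A \<subseteq> X"
  unfolding reach_def walk_def using last_in_set by blast

lemma walk_rev: "walk S X ps \<Longrightarrow> walk S X (rev ps)"
proof -
  have "(\<lambda>x y. step S y x) = step S" by (intro ext) (rule step_commute)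
  then have "successively (step S) (rev ps) \<longleftrightarrow> successively (step S) ps"
    by (subst successively_rev) (rule arg_cong[where f = "\<lambda>P. successively P ps"])
  then show "walk S X ps \<Longrightarrow> walk S X (rev ps)" unfolding walk_def by simp
qed

lemma conn_commute: "conn S X A B \<longleftrightarrow> conn S X B A"
proof -
  have "conn S X B A" if "conn S X A B" for A B
    using that walk_rev unfolding conn_def by (metis hd_rev last_rev)
  then show ?thesis by blast
qed

lemma walk_append_tl:
  assumes "walk S X ps" "walk S X qs" "last ps = hd qs"
  shows "walk S X (ps @ tl qs)" "hd (ps @ tl qs) = hd ps" "last (ps @ tl qs) = last qs"
proof -
  obtain q qs' where qs: "qs = q # qs'" using assms(2) unfolding walk_def by (cases qs) auto
  show "walk S X (ps @ tl qs)" "hd (ps @ tl qs) = hd ps" "last (ps @ tl qs) = last qs"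
    using assms unfolding walk_def qs by (auto simp: successively_append_iff successively_Cons)
qed

lemma reach_trans:
  assumes "x \<in> reach S X A" "walk S X ps" "hd ps = x"
  shows "last ps \<in> reach S X A"
proof -
  obtain qs where qs: "walk S X qs" "hd qs \<in> A" "last qs = x"
    using assms(1) unfolding reach_def by blast
  then have "last qs = hd ps" using assms(3) by simp
  from walk_append_tl[OF qs(1) assms(2) this] qs(2) show ?thesis
    unfolding reach_def by (intro CollectI exI[of _ "qs @ tl ps"]) simp
qed

lemma reach_walk:
  assumes "walk S X ps" "hd ps \<in> reach S X A" "x \<in> set ps"
  shows "x \<in> reach S X A"
proof -
  obtain xs ys where ps: "ps = xs @ x # ys" using assms(3) by (meson split_list)
  have "walk S X (xs @ [x])" "hd (xs @ [x]) = hd ps"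
    using assms(1) unfolding walk_def ps by (auto simp: successively_append_iff hd_append)
  then show ?thesis using reach_trans[OF assms(2), of "xs @ [x]"] by simp
qed

lemma walk_subset_reach:
  assumes "walk S X ps" "hd ps \<in> A"
  shows "set ps \<subseteq> reach S X A"
proof -
  have "walk S X [hd ps]" using assms(1) unfolding walk_def by (cases ps) auto
  then have "hd ps \<in> reach S X A"
    using assms(2) unfolding reach_def by (intro CollectI exI[of _ "[hd ps]"]) simp
  then show ?thesis using reach_walk[OF assms(1)] by blast
qed

text \<open>Loop erasure: cut out the section between two visits to the same vertex and repeat with
  the shorter walk.\<close>

lemma walk_distinct:
  assumes "walk S X ps"
  shows "\<exists>qs. walk S X qs \<and> distinct qs \<and> hd qs = hd ps \<and> last qs = last ps"
  using assms
proof (induction "length ps" arbitrary: ps rule: less_induct)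
  case less
  show ?case
  proof (cases "distinct ps")
    case False
    then obtain xs ys zs y where ps: "ps = xs @ [y] @ ys @ [y] @ zs"
      using not_distinct_decomp by blast
    let ?qs = "xs @ [y] @ zs"
    have "walk S X ?qs"
      using less.prems unfolding ps walk_def by (auto simp: successively_append_iff successively_Cons)
    moreover have "hd ?qs = hd ps" "last ?qs = last ps"
      unfolding ps by (auto simp: hd_append)
    moreover have "length ?qs < length ps" unfolding ps by simp
    ultimately show ?thesis using less.hyps by metis
  qed (use less.prems in blast)
qed

text \<open>Serves to isolate the first edge of a path that a configuration lacks; the piece up to
  \<open>p\<close> is then a path in that configuration.\<close>

lemma not_successively_split:
  assumes "\<not> successively P xs"
  shows "\<exists>as p q bs. xs = as @ p # q # bs \<and> successively P (as @ [p]) \<and> \<not> P p q"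
  using assms
proof (induction xs)
  case (Cons x xs)
  show ?case
  proof (cases "successively P xs")
    case True
    with Cons.prems obtain y ys where "xs = y # ys" "\<not> P x y"
      by (cases xs) (auto simp: successively_Cons)
    then show ?thesis by (intro exI[of _ "[]"]) auto
  next
    case False
    then obtain as p q bs where *: "xs = as @ p # q # bs" "successively P (as @ [p])" "\<not> P p q"
      using Cons.IH by blast
    show ?thesis
    proof (cases "P x (hd xs)")
      case True
      then have "successively P ((x # as) @ [p])"
        using * by (auto simp: successively_Cons hd_append)
      then show ?thesis using * by (intro exI[of _ "x # as"]) auto
    next
      case False
      then show ?thesis
        using * by (intro exI[of _ "[]"] exI[of _ x] exI[of _ "hd xs"] exI[of _ "tl xs"]) auto
    qed
  qed
qed simp

lemma successively_iff_nth:
  "successively P xs \<longleftrightarrow> (\<forall>i < length xs - 1. P (xs ! i) (xs ! (i + 1)))"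
proof (induction xs)
  case (Cons x xs)
  show ?case
  proof (cases xs)
    case (Cons y ys)
    show ?thesis
      using Cons.IH Cons by (simp add: successively_Cons All_less_Suc2)
  qed simp
qed simp

lemma connects_iff_conn:
  assumes "X \<subseteq> slab k"
  shows "connects k (\<lambda>e. e \<in> S) X A B \<longleftrightarrow> conn S X A B"
  using assms unfolding connects_def conn_def walk_def successively_iff_nth step_def by auto

text \<open>Paths are compared through their oriented edges and not their vertices, because the rank
  of a continuation depends on the vertex that it leaves.\<close>

definition steps :: "'a list \<Rightarrow> ('a \<times> 'a) list" where
  "steps ps = zip ps (tl ps)"

lemma steps_simps [simp]:
  "steps [] = []" "steps [x] = []" "steps (x # y # zs) = (x, y) # steps (y # zs)"
  by (auto simp: steps_def)

lemma steps_append: "steps (xs @ w # zs) = steps (xs @ [w]) @ steps (w # zs)"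
proof (induction xs)
  case (Cons x xs)
  then show ?case by (cases xs) auto
qed simp

lemma steps_split:
  "steps ps = us @ (a, b) # vs \<Longrightarrow>
    \<exists>pre post. ps = pre @ a # b # post \<and> steps (pre @ [a]) = us \<and> steps (b # post) = vs"
proof (induction us arbitrary: ps)
  case Nil
  then obtain post where "ps = a # b # post" by (cases ps rule: remdups_adj.cases) auto
  then show ?case using Nil by (intro exI[of _ "[]"] exI[of _ post]) simp
next
  case (Cons u us)
  then obtain x y zs where ps: "ps = x # y # zs" by (cases ps rule: remdups_adj.cases) auto
  with Cons.prems have u: "u = (x, y)" and "steps (y # zs) = us @ (a, b) # vs" by auto
  then obtain pre post where *: "y # zs = pre @ a # b # post" "steps (pre @ [a]) = us"
    "steps (b # post) = vs"
    using Cons.IH by blast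
  then have "steps ((x # pre) @ [a]) = u # us" using u by (cases pre) auto
  then show ?case using * ps by (intro exI[of _ "x # pre"] exI[of _ post]) simp
qed

lemma successively_iff_steps: "successively P ps \<longleftrightarrow> (\<forall>(x, y)\<in>set (steps ps). P x y)"
  by (induction ps rule: remdups_adj.induct) auto

text \<open>A one-vertex list has no steps and its vertex is lost; from length 2 on, the first step
  records the starting point.\<close>

lemma steps_inj:
  assumes "steps ps = steps qs" "2 \<le> length ps" "2 \<le> length qs"
  shows "ps = qs"
  using assms
proof (induction ps arbitrary: qs rule: remdups_adj.induct)
  case (3 x y xs)
  obtain x' y' ys where qs: "qs = x' # y' # ys" using "3.prems"(3) by (cases qs rule: remdups_adj.cases) auto
  have eq: "steps (y # xs) = steps (y' # ys)" "x = x'" "y = y'"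
    using "3.prems"(1) qs by auto
  have "y # xs = y' # ys"
  proof (cases xs)
    case Nil
    then have "ys = []" using eq(1) by (cases ys) auto
    then show ?thesis using Nil eq by simp
  next
    case (Cons a as)
    then obtain b bs where "ys = b # bs" using eq(1) by (cases ys) auto
    then show ?thesis using "3.IH"(1)[of "y' # ys"] "3.IH"(2)[of "y' # ys"] Cons eq(1) by (cases "x = y") auto
  qed
  then show ?case using eq qs by auto
qed auto

lemma steps_unique:
  assumes "distinct ps" "(u, a) \<in> set (steps ps)" "(u, b) \<in> set (steps ps)"
  shows "a = b"
proof -
  obtain us vs where "steps ps = us @ (u, a) # vs" using assms(2) by (meson split_list)
  then obtain p1 q1 where 1: "ps = p1 @ u # a # q1" using steps_split by metis
  obtain us' vs' where "steps ps = us' @ (u, b) # vs'" using assms(3) by (meson split_list)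
  then obtain p2 q2 where 2: "ps = p2 @ u # b # q2" using steps_split by metis
  have "u \<notin> set p1" "u \<notin> set (a # q1)" using assms(1) 1 by auto
  moreover have "p1 @ u # a # q1 = p2 @ u # b # q2" using 1 2 by simp
  ultimately show ?thesis using append_Cons_eq_iff[of u p1 "a # q1" p2 "b # q2"] by simp
qed

lemma in_set_steps: "(x, y) \<in> set (steps ps) \<Longrightarrow> x \<in> set ps \<and> y \<in> set ps"
  by (induction ps rule: remdups_adj.induct) (auto split: if_splits)

text \<open>Used for circuits and for paths alike; for circuits it is the predicate under the
  \<open>THE\<close> of \<open>min_circuit\<close>.\<close>

definition is_least :: "('a \<times> 'a) set \<Rightarrow> 'a set \<Rightarrow> 'a \<Rightarrow> bool" where
  "is_least r A a \<longleftrightarrow> a \<in> A \<and> (\<forall>b\<in>A. b \<noteq> a \<longrightarrow> (a, b) \<in> r)"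

lemma is_least_subset: "is_least r A a \<Longrightarrow> B \<subseteq> A \<Longrightarrow> a \<in> B \<Longrightarrow> is_least r B a"
  unfolding is_least_def by blast

lemma is_least_unique: "is_least r A a \<Longrightarrow> is_least r A b \<Longrightarrow> trans r \<Longrightarrow> irrefl r \<Longrightarrow> a = b"
  unfolding is_least_def by (metis irreflD transD)

lemma is_least_exists:
  assumes "finite A" "A \<noteq> {}" "trans r" "total_on A r"
  shows "\<exists>a. is_least r A a"
  using assms(1,2,4)
proof (induction A rule: finite_ne_induct)
  case (insert x A)
  have "total_on A r" using insert.prems unfolding total_on_def by simp
  then obtain a where a: "is_least r A a" using insert.IH by blast
  show ?case
  proof (cases "(x, a) \<in> r")
    case True
    have "(x, b) \<in> r" if "b \<in> A" for b
      using that True a transD[OF assms(3) True, of b] unfolding is_least_def by (cases "b = a") auto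
    then have "is_least r (insert x A) x" unfolding is_least_def by blast
    then show ?thesis by blast
  next
    case False
    have "x \<noteq> a" using a insert.hyps unfolding is_least_def by blast
    then have "(a, x) \<in> r"
      using False a insert.prems unfolding is_least_def total_on_def by blast
    then have "is_least r (insert x A) a" using a unfolding is_least_def by blast
    then show ?thesis by blast
  qed
qed (auto simp: is_least_def)

section \<open>Ranking of steps and the order on paths\<close>

lemma vprec_irrefl: "\<not> vprec x x"
  by (cases x) (auto simp: vprec_def lexlt3_def)

lemma vprec_trans: "vprec x y \<Longrightarrow> vprec y z \<Longrightarrow> vprec x z"
  by (cases x; cases y; cases z) (auto simp: vprec_def lexlt3_def)

lemma vprec_total: "x \<noteq> y \<Longrightarrow> vprec x y \<or> vprec y x"
  by (cases x; cases y) (auto simp: vprec_def lexlt3_def)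

definition ht :: "vtx \<Rightarrow> int" where "ht v = snd (snd v)"

lemma vtx_eq_iff: "x = y \<longleftrightarrow> proj x = proj y \<and> ht x = ht y"
  by (cases x; cases y) (auto simp: proj_def ht_def)

lemma adj_same_column: "proj x = proj y \<Longrightarrow> adj x y \<longleftrightarrow> \<bar>ht x - ht y\<bar> = 1"
  by (cases x; cases y) (auto simp: proj_def ht_def adj_def)

text \<open>
  Every vertex ranks horizontal steps before vertical ones; the set $r$ holds the vertices that rank
  the step upwards last.
\<close>

definition lvl :: "vtx set \<Rightarrow> vtx \<Rightarrow> vtx \<Rightarrow> nat" where
  "lvl r w a = (if proj a \<noteq> proj w then 0 else if (ht w < ht a) = (w \<in> r) then 2 else 1)"

text \<open>The comparison of different vertices \<open>w\<close>, \<open>w'\<close> decides only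
  between paths with different starting points: after a common nonempty list of steps both paths
  stand at the same vertex.\<close>

definition sord :: "vtx set \<Rightarrow> ((vtx \<times> vtx) \<times> (vtx \<times> vtx)) set" where
  "sord r = {((w, a), (w', b)). vprec w w' \<or>
     w = w' \<and> (lvl r w a < lvl r w b \<or> lvl r w a = lvl r w b \<and> vprec a b)}"

definition pord :: "vtx set \<Rightarrow> (vtx list \<times> vtx list) set" where
  "pord r = {(p, q). (steps p, steps q) \<in> lexord (sord r)}"

lemma sord_trans: "trans (sord r)"
  unfolding sord_def by (rule transI) (auto dest: vprec_trans)

lemma sord_irrefl: "irrefl (sord r)"
  unfolding sord_def irrefl_def by (auto simp: vprec_irrefl)

lemma sord_total: "total (sord r)"
proof (rule totalI)
  fix s t :: "vtx \<times> vtx"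
  assume "s \<noteq> t"
  moreover obtain w a w' b where "s = (w, a)" "t = (w', b)" by (metis surj_pair)
  ultimately show "(s, t) \<in> sord r \<or> (t, s) \<in> sord r"
    using vprec_total[of w w'] vprec_total[of a b] unfolding sord_def
    by (cases "w = w'"; cases "lvl r w a = lvl r w b") auto
qed

lemma pord_trans: "trans (pord r)"
  unfolding pord_def by (rule transI) (auto intro: lexord_trans[OF _ _ sord_trans])

lemma pord_irrefl: "irrefl (pord r)"
  using lexord_irrefl[OF sord_irrefl] unfolding pord_def irrefl_def by auto

lemma pord_linear:
  assumes "2 \<le> length p" "2 \<le> length q" "p \<noteq> q"
  shows "(p, q) \<in> pord r \<or> (q, p) \<in> pord r"
  using total_lexord[OF sord_total, of r] steps_inj[of p q] assms
  unfolding pord_def total_on_def by blast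

definition paths :: "edge set \<Rightarrow> vtx set \<Rightarrow> vtx set \<Rightarrow> vtx set \<Rightarrow> vtx list set" where
  "paths S R A B = {ps. walk S R ps \<and> distinct ps \<and> hd ps \<in> A \<and> last ps \<in> B}"

lemma paths_length:
  assumes "A \<inter> B = {}" "ps \<in> paths S R A B"
  shows "2 \<le> length ps"
  using assms unfolding paths_def walk_def by (cases ps rule: remdups_adj.cases) auto

lemma finite_paths: "finite R \<Longrightarrow> finite (paths S R A B)"
proof (rule finite_subset)
  assume R: "finite R"
  show "paths S R A B \<subseteq> {ps. set ps \<subseteq> R \<and> length ps \<le> card R}"
    using R unfolding paths_def walk_def by (metis (mono_tags, lifting) card_mono distinct_card mem_Collect_eq subsetI)
qed (rule finite_lists_length_le)

lemma paths_mono: "S \<subseteq> S' \<Longrightarrow> paths S R A B \<subseteq> paths S' R A B"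
  unfolding paths_def by (auto intro: walk_mono)

lemma conn_paths: "conn S R A B \<longleftrightarrow> paths S R A B \<noteq> {}"
  unfolding conn_def paths_def using walk_distinct by fastforce

text \<open>Disjointness of \<open>A\<close> and \<open>B\<close> excludes one-vertex paths, which
  \<open>pord\<close> cannot tell apart.\<close>

lemma least_path_exists:
  assumes "finite R" "A \<inter> B = {}" "conn S R A B"
  shows "\<exists>\<pi>. is_least (pord r) (paths S R A B) \<pi>"
proof (rule is_least_exists[OF finite_paths[OF assms(1)] _ pord_trans])
  show "paths S R A B \<noteq> {}" using assms(3) by (simp add: conn_paths)
  show "total_on (paths S R A B) (pord r)"
    unfolding total_on_def by (meson assms(2) paths_length pord_linear)
qed

section \<open>Vertical bridges inside a column\<close>

definition vseg :: "vtx \<Rightarrow> vtx \<Rightarrow> vtx set" where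
  "vseg u v = {x. proj x = proj u \<and> min (ht u) (ht v) \<le> ht x \<and> ht x \<le> max (ht u) (ht v)}"

definition vedges :: "vtx \<Rightarrow> vtx \<Rightarrow> edge set" where
  "vedges u v = {{x, y} | x y. x \<in> vseg u v \<and> y \<in> vseg u v \<and> adj x y}"

definition nxtv :: "vtx \<Rightarrow> vtx \<Rightarrow> vtx" where
  "nxtv u v = (fst u, fst (snd u), ht u + sgn (ht v - ht u))"

lemma nxtv_simps [simp]: "proj (nxtv u v) = proj u" "ht (nxtv u v) = ht u + sgn (ht v - ht u)"
  by (auto simp: nxtv_def proj_def ht_def)

lemma in_vedges: "{x, y} \<in> vedges u v \<Longrightarrow> x \<in> vseg u v \<and> y \<in> vseg u v \<and> adj x y"
  unfolding vedges_def mem_Collect_eq doubleton_eq_iff by (metis adj_commute)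

text \<open>\<open>u\<close> is an end of the segment, so a path that enters the bridge from
  \<open>u\<close> has no choice of its first new step.\<close>

lemma vedges_at_start:
  assumes "{u, y} \<in> vedges u v"
  shows "y = nxtv u v"
proof -
  have y: "proj y = proj u" "adj u y" "y \<in> vseg u v"
    using in_vedges[OF assms] by (auto simp: vseg_def)
  then have "\<bar>ht u - ht y\<bar> = 1" using adj_same_column by metis
  then have "ht y = ht u + sgn (ht v - ht u)"
    using y(3) unfolding vseg_def sgn_if by (simp split: if_splits) arith
  then show ?thesis using y(1) by (simp add: vtx_eq_iff)
qed

lemma vseg_ends: "proj u = proj v \<Longrightarrow> u \<in> vseg u v \<and> v \<in> vseg u v"
  by (auto simp: vseg_def)

lemma vseg_walk:
  assumes "x \<in> vseg u v"
  shows "\<exists>ps. walk (vedges u v) (vseg u v) ps \<and> hd ps = u \<and> last ps = x"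
  using assms
proof (induction "nat \<bar>ht x - ht u\<bar>" arbitrary: x)
  case 0
  then have "x = u" by (auto simp: vtx_eq_iff vseg_def)
  then show ?case using 0 by (intro exI[of _ "[u]"]) (auto simp: walk_def)
next
  case (Suc n)
  define x' where "x' = nxtv x u"
  have h: "ht x' = ht x + sgn (ht u - ht x)" "proj x' = proj x" by (simp_all add: x'_def)
  have "ht x \<noteq> ht u" using Suc(2) by auto
  then have x': "x' \<in> vseg u v" "n = nat \<bar>ht x' - ht u\<bar>" "\<bar>ht x' - ht x\<bar> = 1"
    using Suc(2,3) h unfolding vseg_def sgn_if by (simp_all split: if_splits)
  then have "adj x' x" using adj_same_column h(2) by metis
  note x' = x' this
  then obtain ps where ps: "walk (vedges u v) (vseg u v) ps" "hd ps = u" "last ps = x'"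
    using Suc.hyps(1) by blast
  have "step (vedges u v) x' x"
    using x' Suc.prems unfolding step_def vedges_def by blast
  then have "walk (vedges u v) (vseg u v) (ps @ [x])" "hd (ps @ [x]) = u" "last (ps @ [x]) = x"
    using ps Suc.prems unfolding walk_def by (auto simp: successively_append_iff)
  then show ?case by blast
qed

section \<open>Stability of the least path\<close>

lemma steps_append2: "steps (xs @ w # a # zs) = steps (xs @ [w]) @ (w, a) # steps (a # zs)"
  by (subst steps_append) simp

lemma steps_eq_Nil: "steps ps = [] \<longleftrightarrow> length ps \<le> 1"
  by (cases ps rule: remdups_adj.cases) auto

lemma paths_steps: "ps \<in> paths S R A B \<Longrightarrow> (x, y) \<in> set (steps ps) \<Longrightarrow> step S x y"
  unfolding paths_def walk_def successively_iff_steps by blast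

lemma steps_unchanged:
  assumes "ps \<in> paths S' R A B" "\<And>x y. (x, y) \<in> set (steps ps) \<Longrightarrow> {x, y} \<in> S"
  shows "ps \<in> paths S R A B"
  using assms unfolding paths_def walk_def successively_iff_steps step_def by blast

lemma pord_hd:
  assumes "hd p \<noteq> hd q" "2 \<le> length p" "2 \<le> length q" "(p, q) \<in> pord r"
  shows "vprec (hd p) (hd q)"
proof -
  obtain a b p' where "p = a # b # p'" using assms(2) by (cases p rule: remdups_adj.cases) auto
  moreover obtain c d q' where "q = c # d # q'" using assms(3) by (cases q rule: remdups_adj.cases) auto
  ultimately show ?thesis using assms(1,4) by (auto simp: pord_def sord_def)
qed

lemma pord_branch:
  assumes "(pre @ w # a # p, pre @ w # b # q) \<in> pord r" "a \<noteq> b"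
  shows "((w, a), (w, b)) \<in> sord r"
proof -
  have "(steps (pre @ w # a # p), steps (pre @ w # b # q)) \<in> lexord (sord r)"
    using assms(1) unfolding pord_def by blast
  then have "((w, a) # steps (a # p), (w, b) # steps (b # q)) \<in> lexord (sord r)"
    unfolding steps_append2[of pre w] lexord_same_pref_if_irrefl[OF sord_irrefl] .
  then show ?thesis using assms(2) by simp
qed

lemma walk_join_distinct:
  assumes "walk S X ps" "walk S X qs" "last ps = hd qs"
  shows "\<exists>\<kappa>. walk S X \<kappa> \<and> distinct \<kappa> \<and> hd \<kappa> = hd ps \<and> last \<kappa> = last qs"
  using walk_distinct[OF walk_append_tl(1)[OF assms]] walk_append_tl(2,3)[OF assms] by simp

lemma walk_tail: "walk S X (xs @ u # ys) \<Longrightarrow> walk S X (u # ys)"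
  unfolding walk_def by (auto simp: successively_append_iff)

lemma walk_init: "walk S X (xs @ u # ys) \<Longrightarrow> walk S X (xs @ [u])"
  unfolding walk_def by (auto simp: successively_append_iff)

text \<open>
  A path using the new edges and preceding $\pi$ would leave $\pi$ before reaching $u$; replacing its
  part after $u$ by the tail of $\pi$ would give an old path preceding $\pi$.
\<close>

lemma least_path_preserved:
  assumes AB: "A \<inter> B = {}"
    and least: "is_least (pord r) (paths S R A B) \<pi>"
    and \<pi>: "\<pi> = xs @ u # y # ys"
    and lv: "lvl r u y < lvl r u (nxtv u v)"
    and sep: "vseg u v \<inter> reach S R A \<subseteq> {u}"
  shows "is_least (pord r) (paths (S \<union> vedges u v) R A B) \<pi>"
  unfolding is_least_def
proof (intro conjI ballI impI)
  let ?S' = "S \<union> vedges u v"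
  have \<pi>S: "\<pi> \<in> paths S R A B" using least unfolding is_least_def by blast
  then have \<pi>w: "walk S R \<pi>" "distinct \<pi>" "hd \<pi> \<in> A" "last \<pi> \<in> B" unfolding paths_def by auto
  show "\<pi> \<in> paths ?S' R A B" using \<pi>S paths_mono by blast
  fix \<rho> assume \<rho>: "\<rho> \<in> paths ?S' R A B" and ne: "\<rho> \<noteq> \<pi>"
  then have \<rho>w: "walk ?S' R \<rho>" "distinct \<rho>" "hd \<rho> \<in> A" "last \<rho> \<in> B" unfolding paths_def by auto
  show "(\<pi>, \<rho>) \<in> pord r"
  proof (cases "\<rho> \<in> paths S R A B")
    case True
    then show ?thesis using least ne unfolding is_least_def by blast
  next
    case False
    have len: "2 \<le> length \<pi>" "2 \<le> length \<rho>"
      using \<pi>S \<rho> AB by (auto dest: paths_length)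
    have "\<not> successively (step S) \<rho>"
      using False \<rho> unfolding paths_def walk_def by blast
    \<comment> \<open>The first new edge of \<rho>. What precedes it is an old path from
      \<open>A\<close>, so \<open>p\<close> is a bridge vertex in the old cluster, and
      \<open>sep\<close> leaves only \<open>u\<close>.\<close>
    then obtain as p q bs where split: "\<rho> = as @ p # q # bs" "successively (step S) (as @ [p])"
      "\<not> step S p q"
      using not_successively_split by blast
    have "step ?S' p q"
      using \<rho>w(1) unfolding split walk_def by (auto simp: successively_append_iff)
    then have pq: "{p, q} \<in> vedges u v" "{p, q} \<notin> S" using split(3) unfolding step_def by auto
    have wp: "walk S R (as @ [p])" using split \<rho>w(1) unfolding walk_def by auto
    moreover have "hd (as @ [p]) = hd \<rho>" unfolding split by (cases as) auto
    ultimately have "p \<in> reach S R A"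
      using \<rho>w(3) unfolding reach_def by (intro CollectI exI[of _ "as @ [p]"]) simp
    then have pu: "p = u" using in_vedges[OF pq(1)] sep by blast
    have q: "q = nxtv u v" using vedges_at_start pq(1) pu by blast
    have uqS: "(u, q) \<notin> set (steps \<pi>)" using paths_steps[OF \<pi>S] pq(2) pu unfolding step_def by blast
    have uq\<rho>: "(u, q) \<in> set (steps \<rho>)" unfolding split pu steps_append2[of as] by simp
    show ?thesis
    proof (rule ccontr)
      assume "(\<pi>, \<rho>) \<notin> pord r"
      then have lt: "(\<rho>, \<pi>) \<in> pord r" using pord_linear[OF len] ne by blast
      show False
      proof (cases "hd \<rho> = hd \<pi>")
        case False
        then have vp: "vprec (hd \<rho>) (hd \<pi>)" using pord_hd lt len by blast
        have "walk S R (u # y # ys)" using \<pi>w(1) walk_tail unfolding \<pi> by blast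
        \<comment> \<open>Old beginning of \<rho> up to \<open>u\<close>, continued by the end of
          \<pi>: an old path with a smaller starting point than \<pi>, which is impossible.\<close>
        from walk_join_distinct[OF wp[unfolded pu] this] obtain \<kappa> where
          \<kappa>: "walk S R \<kappa>" "distinct \<kappa>" "hd \<kappa> = hd (as @ [u])" "last \<kappa> = last (u # y # ys)"
          by auto
        have hd\<kappa>: "hd \<kappa> = hd \<rho>" using \<kappa>(3) unfolding split pu by (cases as) auto
        have "last \<kappa> = last \<pi>" using \<kappa>(4) unfolding \<pi> by simp
        then have \<kappa>P: "\<kappa> \<in> paths S R A B" using \<kappa> hd\<kappa> \<rho>w(3) \<pi>w(4) unfolding paths_def by simp
        have "\<kappa> \<noteq> \<pi>" using hd\<kappa> False by auto
        then have "(\<pi>, \<kappa>) \<in> pord r" using least \<kappa>P unfolding is_least_def by blast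
        moreover have "hd \<pi> \<noteq> hd \<kappa>" using hd\<kappa> False by simp
        ultimately have "vprec (hd \<pi>) (hd \<kappa>)"
          using pord_hd len(1) paths_length[OF AB \<kappa>P] by blast
        then have "vprec (hd \<pi>) (hd \<rho>)" using hd\<kappa> by simp
        from vprec_trans[OF vp this] show False using vprec_irrefl by blast
      next
        case True
        from lt consider
            (prefix) a w where "steps \<pi> = steps \<rho> @ a # w"
          | (branch) us a1 a2 b1 b2 vs ws where "((a1, a2), (b1, b2)) \<in> sord r"
              "steps \<rho> = us @ (a1, a2) # vs" "steps \<pi> = us @ (b1, b2) # ws"
          unfolding pord_def lexord_def by auto
        then show False
        proof cases
          \<comment> \<open>Here \<pi> would contain all steps of \<rho>, among them the new one out
            of \<open>u\<close>.\<close>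
          case prefix
          then show False using uqS uq\<rho> by simp
        next
          case branch
          obtain pre post where \<rho>s: "\<rho> = pre @ a1 # a2 # post" "steps (pre @ [a1]) = us"
            "steps (a2 # post) = vs" using steps_split[OF branch(2)] by blast
          obtain pre' post' where \<pi>s: "\<pi> = pre' @ b1 # b2 # post'" "steps (pre' @ [b1]) = us"
            "steps (b2 # post') = ws" using steps_split[OF branch(3)] by blast
          \<comment> \<open>With no common steps the starting vertices are not recorded in
            \<open>us\<close>; their equality comes from the case assumption on the heads.\<close>
          have same: "pre @ [a1] = pre' @ [b1]"
          proof (cases "pre = [] \<or> pre' = []")
            case True
            then have "us = []" using \<rho>s(2) \<pi>s(2) by auto
            then have "pre = [] \<and> pre' = []"
              using \<rho>s(2) \<pi>s(2) by (simp add: steps_eq_Nil)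
            then show ?thesis using \<open>hd \<rho> = hd \<pi>\<close> \<rho>s(1) \<pi>s(1) by simp
          next
            case False
            then have "2 \<le> length (pre @ [a1])" "2 \<le> length (pre' @ [b1])"
              by (cases pre; simp)(cases pre'; use False in simp)
            then show ?thesis using steps_inj \<rho>s(2) \<pi>s(2) by metis
          qed
          then have [simp]: "pre' = pre" "b1 = a1" by auto
          have a2b2: "a2 \<noteq> b2" using branch(1) irreflD[OF sord_irrefl[of r], of "(a1, a2)"] by (cases "a2 = b2") simp_all
          have "(u, q) \<notin> set us" using uqS branch(3) by auto
          then consider "(u, q) = (a1, a2)" | "(u, q) \<in> set vs" using uq\<rho> branch(2) by auto
          then show False
          proof cases
            \<comment> \<open>Branching at \<open>u\<close> itself: \<pi> continues to
              \<open>y\<close>, which \<open>lv\<close> ranks before the bridge.\<close>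
            case 1
            have "(u, b2) \<in> set (steps \<pi>)" using 1 branch(3) by auto
            moreover have "(u, y) \<in> set (steps \<pi>)" unfolding \<pi> steps_append2[of xs] by simp
            ultimately have "b2 = y" by (rule steps_unique[OF \<pi>w(2)])
            then have "((u, q), (u, y)) \<in> sord r" using branch(1) 1 by simp
            then show False using lv vprec_irrefl[of u] unfolding q sord_def by simp
          next
            case 2
            then have ua2: "u \<in> set (a2 # post)" using \<rho>s(3) in_set_steps by fast
            have "u \<notin> set (pre @ [a1])" using ua2 \<rho>w(2) unfolding \<rho>s by auto
            moreover have "u \<in> set \<pi>" unfolding \<pi> by simp
            ultimately have "u \<in> set (b2 # post')" unfolding \<pi>s by auto
            then obtain es fs where es: "b2 # post' = es @ u # fs" by (meson split_list)
            obtain cs ds where cs: "a2 # post = cs @ u # ds" using ua2 by (meson split_list)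
            have eq: "as @ u # q # bs = (pre @ a1 # cs) @ u # ds"
              using split(1) \<rho>s(1) cs pu by simp
            have "u \<notin> set as" "u \<notin> set (q # bs)" using \<rho>w(2) unfolding split pu by auto
            then have as: "as = pre @ a1 # cs"
              using eq append_Cons_eq_iff[of u as "q # bs" "pre @ a1 # cs" ds] by simp
            \<comment> \<open>Removing the common initial piece makes loop erasure safe: the joined
              path cannot run back into it, and the branching step from \<open>a1\<close> to
              \<open>a2\<close> survives.\<close>
            define X where "X = R - set (pre @ [a1])"
            have "walk S R (cs @ [u])" using wp walk_tail[of S R "pre @ [a1]"]
              unfolding as pu by (cases cs) auto
            moreover have "set (cs @ [u]) \<inter> set (pre @ [a1]) = {}"
              using \<rho>w(2) unfolding split pu as by auto
            ultimately have w1: "walk S X (cs @ [u])" unfolding walk_def X_def by blast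
            have "walk S R (u # fs)"
              using \<pi>w(1) walk_tail[of S R "pre @ a1 # es"] unfolding \<pi>s es by simp
            moreover have "set (u # fs) \<inter> set (pre @ [a1]) = {}"
              using \<pi>w(2) unfolding \<pi>s es by auto
            ultimately have w2: "walk S X (u # fs)" unfolding walk_def X_def by blast
            from walk_join_distinct[OF w1 w2] obtain \<kappa>' where \<kappa>': "walk S X \<kappa>'" "distinct \<kappa>'"
              "hd \<kappa>' = hd (cs @ [u])" "last \<kappa>' = last (u # fs)" by auto
            have "hd \<kappa>' = a2" using \<kappa>'(3) cs by (cases cs) auto
            then obtain \<kappa>'' where \<kappa>'': "\<kappa>' = a2 # \<kappa>''" using \<kappa>'(1) unfolding walk_def by (cases \<kappa>') auto
            let ?\<kappa> = "pre @ a1 # a2 # \<kappa>''"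
            have "step S a1 a2"
            proof -
              have "successively (step S) (pre @ a1 # cs @ [u])" using wp unfolding as pu walk_def by simp
              then have "successively (step S) (a1 # cs @ [u])" by (simp add: successively_append_iff)
              then show ?thesis using cs by (cases cs) auto
            qed
            moreover have "walk S R (pre @ [a1])" using \<pi>w(1) walk_init[of S R pre a1] unfolding \<pi>s by simp
            moreover have "set \<kappa>' \<subseteq> X" using \<kappa>'(1) unfolding walk_def by blast
            ultimately have "walk S R ?\<kappa>" "distinct ?\<kappa>"
              using \<kappa>'(1,2) \<pi>w(2) unfolding walk_def \<kappa>'' X_def \<pi>s by (auto simp: successively_append_iff)
            moreover have "hd ?\<kappa> = hd \<rho>" unfolding \<rho>s by (cases pre) auto
            moreover have "last ?\<kappa> = last \<pi>"
            proof -
              have "last ?\<kappa> = last \<kappa>'" unfolding \<kappa>'' by simp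
              also have "\<dots> = last (b2 # post')" unfolding \<kappa>'(4) es by simp
              finally show ?thesis unfolding \<pi>s by simp
            qed
            ultimately have \<kappa>P: "?\<kappa> \<in> paths S R A B" using \<rho>w(3) \<pi>w(4) unfolding paths_def by simp
            \<comment> \<open>The new path is old and leaves \<pi> by the same step as \<rho>, so
              minimality of \<pi> ranks the two steps out of \<open>a1\<close> in the opposite
              way.\<close>
            have "?\<kappa> \<noteq> \<pi>" using a2b2 unfolding \<pi>s by simp
            then have "(\<pi>, ?\<kappa>) \<in> pord r" using least \<kappa>P unfolding is_least_def by blast
            then have B: "((a1, b2), (a1, a2)) \<in> sord r"
              using pord_branch[of pre a1 b2 post' a2] a2b2 unfolding \<pi>s by simp
            have "((a1, a2), (a1, b2)) \<in> sord r" using branch(1) by simp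
            from transD[OF sord_trans this B] show False using irreflD[OF sord_irrefl] by (rule notE[rotated])
          qed
        qed
      qed
    qed
  qed
qed

text \<open>If the rank condition fails, \<open>y\<close> is vertical, points away from
  \<open>v\<close> and is ranked last at \<open>u\<close>. Flipping the bit at \<open>u\<close> only
  exchanges the two vertical steps there. This promotes the step that \<pi> itself takes, so no
  competitor overtakes \<pi>.\<close>

lemma least_path_flip:
  assumes least: "is_least (pord r) (paths S R A B) \<pi>"
    and \<pi>: "\<pi> = xs @ u # y # ys"
    and uv: "ht u \<noteq> ht v" "y \<noteq> nxtv u v"
    and bad: "\<not> lvl r u y < lvl r u (nxtv u v)"
    and r': "r' = (if u \<in> r then r - {u} else insert u r)"
  shows "is_least (pord r') (paths S R A B) \<pi>" "lvl r' u y < lvl r' u (nxtv u v)"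
proof -
  have \<pi>S: "\<pi> \<in> paths S R A B" using least unfolding is_least_def by blast
  have uy: "(u, y) \<in> set (steps \<pi>)" unfolding \<pi> steps_append2[of xs] by simp
  then have "adj u y" using paths_steps[OF \<pi>S] unfolding step_def by blast
  have col: "proj y = proj u" using bad by (auto simp: lvl_def split: if_splits)
  then have hy: "\<bar>ht u - ht y\<bar> = 1" using \<open>adj u y\<close> adj_same_column by metis
  have "ht y \<noteq> ht (nxtv u v)" using uv(2) col by (metis nxtv_simps(1) vtx_eq_iff)
  then have opp: "(ht u < ht y) \<noteq> (ht u < ht (nxtv u v))"
    using hy uv(1) by (auto simp: sgn_if split: if_splits)
  have flip: "(u \<in> r') = (u \<notin> r)" unfolding r' by auto
  have two: "lvl r u y = 2" using bad opp col by (auto simp: lvl_def split: if_splits)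
  show "lvl r' u y < lvl r' u (nxtv u v)"
    using two opp col flip unfolding lvl_def by (auto split: if_splits)
  have other: "lvl r' w = lvl r w" if "w \<noteq> u" for w
    using that unfolding r' lvl_def by auto
  show "is_least (pord r') (paths S R A B) \<pi>"
    unfolding is_least_def
  proof (intro conjI ballI impI \<pi>S)
    fix \<rho> assume \<rho>: "\<rho> \<in> paths S R A B" "\<rho> \<noteq> \<pi>"
    then have lt: "(\<pi>, \<rho>) \<in> pord r" using least unfolding is_least_def by blast
    then consider
        (prefix) a w where "steps \<rho> = steps \<pi> @ a # w"
      | (branch) us a1 a2 b1 b2 vs ws where "((a1, a2), (b1, b2)) \<in> sord r"
          "steps \<pi> = us @ (a1, a2) # vs" "steps \<rho> = us @ (b1, b2) # ws"
      unfolding pord_def lexord_def by auto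
    then show "(\<pi>, \<rho>) \<in> pord r'"
    proof cases
      case prefix
      have "(steps \<pi>, steps \<rho>) \<in> lexord (sord r')"
        unfolding prefix by (rule lexord_append_rightI) blast
      then show ?thesis unfolding pord_def by simp
    next
      case branch
      have "((a1, a2), (b1, b2)) \<in> sord r'"
      proof (cases "a1 = u \<and> b1 = u")
        case False
        then show ?thesis
          using branch(1) other[of a1] unfolding sord_def by (cases "a1 = b1") simp_all
      next
        case True
        then have "a2 = y" using steps_unique[of \<pi> u a2 y] uy branch(2) \<pi>S unfolding paths_def by auto
        \<comment> \<open>A competitor branching off at \<open>u\<close> would need a step ranked
          after the last-ranked one; this forces \<open>b2 = y\<close>, so there is none.\<close>
        then have "2 \<le> lvl r u b2" using branch(1) True two by (auto simp: sord_def vprec_irrefl)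
        then have b2: "proj b2 = proj u" "(ht u < ht b2) = (u \<in> r)"
          by (auto simp: lvl_def split: if_splits)
        have "adj u b2" using paths_steps[OF \<rho>(1), of u b2] branch(3) True unfolding step_def by auto
        then have "\<bar>ht u - ht b2\<bar> = 1" using b2(1) adj_same_column by metis
        moreover have "(ht u < ht y) = (u \<in> r)" using two col by (auto simp: lvl_def split: if_splits)
        ultimately have "ht b2 = ht y" using hy b2(2) by auto
        then have "b2 = y" using b2(1) col by (simp add: vtx_eq_iff)
        then show ?thesis using branch(1) True \<open>a2 = y\<close> by (auto simp: sord_def vprec_irrefl)
      qed
      then show ?thesis using branch(2,3) unfolding pord_def lexord_def by blast
    qed
  qed
qed

section \<open>Gluing a circuit to a crossing\<close>

definition cedges :: "vtx list \<Rightarrow> edge set" where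
  "cedges c = {{x, y} | x y. (x, y) \<in> set (steps c)}"

lemma cedges_in: "e \<in> cedges c \<Longrightarrow> \<exists>x y. e = {x, y} \<and> x \<in> set c \<and> y \<in> set c"
  unfolding cedges_def using in_set_steps by fast

lemma circ_lex_order: "trans circ_lex" "irrefl circ_lex" "total circ_lex"
proof -
  let ?r = "{(x, y). vprec x y}"
  have "trans ?r" using vprec_trans by (intro transI) blast
  moreover have "irrefl ?r" using vprec_irrefl unfolding irrefl_def by simp
  moreover have "total ?r" using vprec_total unfolding total_on_def by simp
  ultimately show "trans circ_lex" "irrefl circ_lex" "total circ_lex"
    unfolding circ_lex_def by (auto intro: lexord_transI lexord_irrefl total_lexord)
qed

text \<open>Closing every edge at an interior vertex of the bridge isolates the interior, so that it
  cannot belong to the cluster of the target before the bridge is opened.\<close>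

definition inner_cut :: "vtx \<Rightarrow> vtx \<Rightarrow> edge set \<Rightarrow> edge set" where
  "inner_cut u v S = {e \<in> S. e \<inter> (vseg u v - {u, v}) = {}}"

text \<open>The interior of the segment has to avoid both the path \<open>P\<close> and the circuit
  \<open>C\<close>, since \<open>inner_cut\<close> would otherwise destroy them.\<close>

definition nearest :: "vtx set \<Rightarrow> vtx set \<Rightarrow> vtx \<Rightarrow> vtx \<Rightarrow> bool" where
  "nearest P C u v \<longleftrightarrow> u \<in> P \<and> v \<in> C \<and> proj u = proj v \<and> vseg u v \<inter> (P \<union> C) \<subseteq> {u, v}"

text \<open>A pair at least vertical distance works: another point of \<open>P\<close> or
  \<open>C\<close> between its ends would form a closer pair with the end in the other set.\<close>

lemma nearest_exists:
  assumes "x \<in> P" "y \<in> C" "proj x = proj y"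
  shows "\<exists>u v. nearest P C u v"
proof -
  define D where "D = (\<lambda>(u, v). u \<in> P \<and> v \<in> C \<and> proj u = proj v)"
  define d where "d = (\<lambda>(u, v). nat \<bar>ht u - ht v\<bar>)"
  have "D (x, y)" using assms by (simp add: D_def)
  then obtain p where p: "D p" "\<And>q. D q \<Longrightarrow> d p \<le> d q"
    using ex_has_least_nat[of D _ d] by blast
  obtain u v where uv: "p = (u, v)" by (cases p)
  have "vseg u v \<inter> (P \<union> C) \<subseteq> {u, v}"
  proof
    fix w assume w: "w \<in> vseg u v \<inter> (P \<union> C)"
    show "w \<in> {u, v}"
    proof (rule ccontr)
      assume ne: "w \<notin> {u, v}"
      have pr: "proj w = proj u" "proj w = proj v" using w p(1) by (auto simp: vseg_def D_def uv)
      then have h: "ht w \<noteq> ht u" "ht w \<noteq> ht v" using ne vtx_eq_iff by auto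
      have b: "min (ht u) (ht v) \<le> ht w" "ht w \<le> max (ht u) (ht v)" using w by (auto simp: vseg_def)
      have "d (w, v) < d (u, v)" "d (u, w) < d (u, v)"
        using h b unfolding d_def by (auto simp: min_def max_def split: if_splits)
      moreover have "D (w, v) \<or> D (u, w)" using w p(1) pr unfolding D_def uv by auto
      ultimately show False using p(2) uv by (metis leD)
    qed
  qed
  then have "nearest P C u v" using p(1) unfolding nearest_def D_def uv by simp
  then show ?thesis by blast
qed

text \<open>Covers both gluings. The target \<open>T\<close> may depend on the configuration;
  \<open>T_local\<close> says that changes in a column of a circuit of \<open>Fam\<close> do not
  affect it, so a configuration and its image have the same target. \<open>cross\<close> is where
  the winding number enters, and \<open>off\<close> keeps the bridge column away from both ends of
  the path.\<close>

locale gluing =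
  fixes k :: nat and F :: "edge set" and R L :: "vtx set" and T :: "edge set \<Rightarrow> vtx set"
    and Fam :: "vtx list set"
  assumes finF: "finite F" and F_edges: "F \<subseteq> edges k"
    and finR: "finite R"
    and column: "\<And>x y. x \<in> R \<Longrightarrow> proj y = proj x \<Longrightarrow> y \<in> slab k \<Longrightarrow> y \<in> R"
    and R_slab: "R \<subseteq> slab k"
    and R_edges: "\<And>x y. x \<in> R \<Longrightarrow> y \<in> R \<Longrightarrow> adj x y \<Longrightarrow> {x, y} \<in> F"
    and finFam: "finite Fam" and Fam_slab: "\<And>c. c \<in> Fam \<Longrightarrow> set c \<subseteq> slab k"
    and cross: "\<And>c S ps. c \<in> Fam \<Longrightarrow> walk S R ps \<Longrightarrow> hd ps \<in> T S \<Longrightarrow> last ps \<in> L \<Longrightarrow>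
      \<exists>x\<in>set ps. \<exists>y\<in>set c. proj x = proj y"
    and off: "\<And>c S x y. c \<in> Fam \<Longrightarrow> y \<in> set c \<Longrightarrow> x \<in> T S \<union> L \<Longrightarrow> proj x \<noteq> proj y"
    and TL: "\<And>S. T S \<inter> L = {}"
    and T_local: "\<And>c y S S'. c \<in> Fam \<Longrightarrow> y \<in> set c \<Longrightarrow>
      (\<And>e. e \<in> (S - S') \<union> (S' - S) \<Longrightarrow> \<exists>x\<in>e. proj x = proj y) \<Longrightarrow> T S = T S'"
begin

definition opens :: "edge set \<Rightarrow> vtx list set" where
  "opens S = {c \<in> Fam. cedges c \<subseteq> S}"

definition cmin :: "edge set \<Rightarrow> vtx list" where
  "cmin S = (THE c. is_least circ_lex (opens S) c)"

definition pmin :: "vtx set \<Rightarrow> edge set \<Rightarrow> vtx list" where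
  "pmin r S = (THE \<pi>. is_least (pord r) (paths S R (T S) L) \<pi>)"

lemma cmin_eqI: "is_least circ_lex (opens S) c \<Longrightarrow> cmin S = c"
  unfolding cmin_def by (rule the_equality) (auto intro: is_least_unique[OF _ _ circ_lex_order(1,2)])

lemma cmin:
  assumes "opens S \<noteq> {}"
  shows "is_least circ_lex (opens S) (cmin S)"
proof -
  have "finite (opens S)" unfolding opens_def using finFam by simp
  moreover have "total_on (opens S) circ_lex" using circ_lex_order(3) unfolding total_on_def by blast
  ultimately obtain c where "is_least circ_lex (opens S) c"
    using is_least_exists[OF _ assms circ_lex_order(1)] by blast
  then show ?thesis using cmin_eqI by simp
qed

lemma pmin_eqI: "is_least (pord r) (paths S R (T S) L) \<pi> \<Longrightarrow> pmin r S = \<pi>"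
  unfolding pmin_def by (rule the_equality) (auto intro: is_least_unique[OF _ _ pord_trans pord_irrefl])

lemma pmin: "conn S R (T S) L \<Longrightarrow> is_least (pord r) (paths S R (T S) L) (pmin r S)"
  using least_path_exists[OF finR TL, of S S] pmin_eqI by metis

text \<open>Describes the configuration after the cut and before the bridge is opened. From here on
  the surgery only adds edges, and both minimality statements refer to this intermediate
  configuration.\<close>

definition good :: "vtx set \<Rightarrow> vtx set \<Rightarrow> edge set \<Rightarrow> vtx list \<Rightarrow> vtx list \<Rightarrow> vtx \<Rightarrow> vtx \<Rightarrow> bool" where
  "good r A S c \<pi> u v \<longleftrightarrow> is_least circ_lex (opens S) c \<and> is_least (pord r) (paths S R A L) \<pi> \<and>
     set c \<inter> reach S R A = {} \<and> v \<in> set c \<and> proj u = proj v \<and> vseg u v \<inter> reach S R A \<subseteq> {u} \<and>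
     (\<exists>xs y ys. \<pi> = xs @ u # y # ys \<and> lvl r u y < lvl r u (nxtv u v))"

lemma vseg_R:
  assumes "u \<in> R" "v \<in> slab k" "proj u = proj v"
  shows "vseg u v \<subseteq> R"
proof
  fix x assume x: "x \<in> vseg u v"
  have in_slab: "y \<in> slab k \<longleftrightarrow> 0 \<le> ht y \<and> ht y \<le> int k" for y
    by (cases y) (auto simp: slab_def ht_def)
  have "u \<in> slab k" using assms(1) R_slab by blast
  then have "x \<in> slab k" using x assms(2) unfolding vseg_def in_slab by auto
  then show "x \<in> R" using column[OF assms(1)] x unfolding vseg_def by simp
qed

lemma good_facts:
  assumes "good r A S c \<pi> u v"
  shows "c \<in> Fam" "cedges c \<subseteq> S" "\<pi> \<in> paths S R A L" "u \<in> set \<pi>" "u \<in> reach S R A"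
    "set \<pi> \<subseteq> reach S R A" "vseg u v \<subseteq> R"
proof -
  show c: "c \<in> Fam" "cedges c \<subseteq> S" using assms unfolding good_def is_least_def opens_def by auto
  show \<pi>: "\<pi> \<in> paths S R A L" using assms unfolding good_def is_least_def by blast
  show u: "u \<in> set \<pi>" using assms unfolding good_def by auto
  show sub: "set \<pi> \<subseteq> reach S R A" using \<pi> walk_subset_reach unfolding paths_def by blast
  show "u \<in> reach S R A" using u sub by blast
  then have "u \<in> R" using reach_subset by blast
  moreover have "v \<in> slab k" using c(1) Fam_slab assms unfolding good_def by blast
  ultimately show "vseg u v \<subseteq> R" using vseg_R assms unfolding good_def by blast
qed

lemma vseg_reach:
  assumes "u \<in> reach S R A" "vedges u v \<subseteq> S" "vseg u v \<subseteq> R" "x \<in> vseg u v"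
  shows "x \<in> reach S R A"
proof -
  obtain ps where ps: "walk (vedges u v) (vseg u v) ps" "hd ps = u" "last ps = x"
    using vseg_walk[OF assms(4)] by blast
  have "walk S R ps" by (rule walk_mono[OF ps(1) assms(2,3)])
  from reach_trans[OF assms(1) this ps(2)] ps(3) show ?thesis by simp
qed

text \<open>Both configurations have the same path \<pi>, so \<open>u2\<close> is in the cluster of
  \<open>A\<close> in \<open>S1\<close> too, and the open bridge extends this cluster to every
  circuit that uses one of its edges.\<close>

lemma good_no_use:
  assumes "good r A S1 c1 \<pi> u1 v1" "good r A S2 c2 \<pi> u2 v2" "vedges u2 v2 \<subseteq> S1"
  shows "cedges c1 \<inter> vedges u2 v2 = {}"
proof (rule ccontr)
  assume "cedges c1 \<inter> vedges u2 v2 \<noteq> {}"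
  then obtain e where e: "e \<in> cedges c1" "e \<in> vedges u2 v2" by blast
  obtain x y where xy: "e = {x, y}" "x \<in> set c1" using cedges_in[OF e(1)] by blast
  have "x \<in> vseg u2 v2" using in_vedges[of x y u2 v2] e(2) xy(1) by simp
  moreover have "u2 \<in> reach S1 R A" using good_facts(6)[OF assms(1)] good_facts(4)[OF assms(2)] by blast
  ultimately have "x \<in> reach S1 R A" using vseg_reach assms(3) good_facts(7)[OF assms(2)] by blast
  then show False using xy(2) assms(1) unfolding good_def by blast
qed

lemma least_both:
  assumes "is_least r A a" "is_least r B b" "a \<in> B" "b \<in> A" "trans r" "irrefl r"
  shows "a = b"
proof (rule ccontr)
  assume "a \<noteq> b"
  then have "(a, b) \<in> r" "(b, a) \<in> r" using assms(1-4) unfolding is_least_def by auto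
  then show False using transD[OF assms(5), of a b a] irreflD[OF assms(6), of a] by blast
qed

text \<open>Only the column is recovered, not the bridge itself: this already determines a bounded
  set of edges containing all changes.\<close>

lemma column_unique:
  assumes 1: "good r A S1 c1 \<pi>1 u1 v1" and 2: "good r A S2 c2 \<pi>2 u2 v2" and AL: "A \<inter> L = {}"
    and eq: "S1 \<union> vedges u1 v1 = S2 \<union> vedges u2 v2"
  shows "proj u1 = proj u2"
proof (rule ccontr)
  assume ne: "proj u1 \<noteq> proj u2"
  have disj: "vedges u1 v1 \<inter> vedges u2 v2 = {}"
  proof (rule ccontr)
    assume "vedges u1 v1 \<inter> vedges u2 v2 \<noteq> {}"
    then obtain e where e: "e \<in> vedges u1 v1" "e \<in> vedges u2 v2" by blast
    then obtain x y where xy: "e = {x, y}" unfolding vedges_def by blast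
    show False using in_vedges[of x y u1 v1] in_vedges[of x y u2 v2] e ne unfolding xy vseg_def by simp
  qed
  \<comment> \<open>Both bridges are open in the common image and share no edge, so each was open in
    the other configuration before the latter received its own bridge.\<close>
  have sub: "vedges u2 v2 \<subseteq> S1" "vedges u1 v1 \<subseteq> S2" using eq disj by blast+
  have pres: "is_least (pord r) (paths (S \<union> vedges u v) R A L) \<pi>" if g: "good r A S c \<pi> u v" for S c \<pi> u v
  proof -
    obtain xs y ys where "\<pi> = xs @ u # y # ys" "lvl r u y < lvl r u (nxtv u v)"
      using g unfolding good_def by blast
    then show ?thesis using least_path_preserved[OF AL] g unfolding good_def by blast
  qed
  have \<pi>: "\<pi>1 = \<pi>2"
    using is_least_unique[OF _ _ pord_trans pord_irrefl] pres[OF 1] pres[OF 2] unfolding eq by blast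
  have nu: "cedges c1 \<inter> vedges u2 v2 = {}" "cedges c2 \<inter> vedges u1 v1 = {}"
    using good_no_use[of r A S1 c1 \<pi>1 u1 v1 S2 c2 u2 v2] good_no_use[of r A S2 c2 \<pi>1 u2 v2 S1 c1 u1 v1]
      1 2 sub unfolding \<pi> by blast+
  have "c1 \<in> opens S2" "c2 \<in> opens S1"
    using good_facts(1,2)[OF 1] good_facts(1,2)[OF 2] nu eq unfolding opens_def by blast+
  then have c: "c1 = c2"
    using least_both[OF _ _ _ _ circ_lex_order(1,2)] 1 2 unfolding good_def by blast
  have "u1 \<in> reach S2 R A" using good_facts(4)[OF 1] good_facts(6)[OF 2] \<pi> by blast
  moreover have "v1 \<in> vseg u1 v1" using 1 vseg_ends unfolding good_def by blast
  ultimately have "v1 \<in> reach S2 R A" using vseg_reach sub(2) good_facts(7)[OF 1] by blast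
  then show False using 1 2 c unfolding good_def by blast
qed

section \<open>Surgery on configurations with an unconnected circuit\<close>

definition pick :: "vtx list \<Rightarrow> vtx list \<Rightarrow> vtx \<times> vtx" where
  "pick \<pi> c = (SOME uv. nearest (set \<pi>) (set c) (fst uv) (snd uv))"

definition bad :: "edge set \<Rightarrow> bool" where
  "bad S \<longleftrightarrow> opens S \<noteq> {} \<and> conn S R (T S) L \<and> set (cmin S) \<inter> reach S R (T S) = {}"

text \<open>Depends on the bits \<open>r\<close> only through the least path, so that bit sets with
  the same least path get the same bridge.\<close>

definition uv :: "vtx set \<Rightarrow> edge set \<Rightarrow> vtx \<times> vtx" where
  "uv r S = pick (pmin r S) (cmin S)"

definition ranked :: "vtx set \<Rightarrow> edge set \<Rightarrow> bool" where
  "ranked r S \<longleftrightarrow> bad S \<and> (\<exists>xs y ys. pmin r S = xs @ fst (uv r S) # y # ys \<and>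
     lvl r (fst (uv r S)) y < lvl r (fst (uv r S)) (nxtv (fst (uv r S)) (snd (uv r S))))"

definition surgery :: "vtx set \<Rightarrow> edge set \<Rightarrow> edge set" where
  "surgery r S = inner_cut (fst (uv r S)) (snd (uv r S)) S \<union> vedges (fst (uv r S)) (snd (uv r S))"

lemma bad_facts:
  assumes "bad S" and uvd: "uv r S = (u, v)"
  shows "is_least (pord r) (paths S R (T S) L) (pmin r S)" "is_least circ_lex (opens S) (cmin S)"
    "nearest (set (pmin r S)) (set (cmin S)) u v" "ht u \<noteq> ht v" "cmin S \<in> Fam" "cedges (cmin S) \<subseteq> S"
    "pmin r S \<in> paths S R (T S) L" "set (pmin r S) \<subseteq> reach S R (T S)"
    "\<exists>xs y ys. pmin r S = xs @ u # y # ys"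
proof -
  show \<pi>: "is_least (pord r) (paths S R (T S) L) (pmin r S)" using assms pmin unfolding bad_def by blast
  show c: "is_least circ_lex (opens S) (cmin S)" using assms cmin unfolding bad_def by blast
  then show cF: "cmin S \<in> Fam" "cedges (cmin S) \<subseteq> S" unfolding is_least_def opens_def by auto
  show p: "pmin r S \<in> paths S R (T S) L" using \<pi> unfolding is_least_def by blast
  then show sub: "set (pmin r S) \<subseteq> reach S R (T S)" using walk_subset_reach unfolding paths_def by blast
  have "\<exists>x\<in>set (pmin r S). \<exists>y\<in>set (cmin S). proj x = proj y"
    using cross[OF cF(1), of S "pmin r S"] p unfolding paths_def by blast
  then obtain u' v' where "nearest (set (pmin r S)) (set (cmin S)) u' v'"
    using nearest_exists by metis
  then have "nearest (set (pmin r S)) (set (cmin S)) (fst (u', v')) (snd (u', v'))" by simp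
  then have "nearest (set (pmin r S)) (set (cmin S)) (fst (uv r S)) (snd (uv r S))"
    unfolding uv_def pick_def by (rule someI)
  then show n: "nearest (set (pmin r S)) (set (cmin S)) u v" using uvd by simp
  \<comment> \<open>The path lies in the cluster of the target and the circuit outside it; in a
    common column, different points have different heights.\<close>
  then have "u \<noteq> v" using sub assms(1) unfolding bad_def nearest_def by blast
  then show "ht u \<noteq> ht v" using n unfolding nearest_def vtx_eq_iff by blast
  obtain xs zs where z: "pmin r S = xs @ u # zs" using n unfolding nearest_def by (meson split_list)
  \<comment> \<open>The endpoint of the path is in \<open>L\<close>, which by \<open>off\<close>
    shares no column with the circuit; hence \<open>u\<close> has a successor on the path.\<close>
  have "zs \<noteq> []"
  proof
    assume "zs = []"
    then have "u \<in> L" using p z unfolding paths_def by simp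
    then show False using off[OF cF(1), of v u S] n unfolding nearest_def by blast
  qed
  then obtain y ys where "zs = y # ys" using neq_Nil_conv[of zs] by blast
  then show "\<exists>xs y ys. pmin r S = xs @ u # y # ys" using z by blast
qed

text \<open>The cut spares all edges of the path and of the circuit, because both meet the segment
  at most in \<open>u\<close> and \<open>v\<close>. Closing edges only removes competitors, so both
  remain least.\<close>

lemma surgery_facts:
  assumes D: "ranked r S" and uvd: "uv r S = (u, v)"
  shows "good r (T S) (inner_cut u v S) (cmin S) (pmin r S) u v" "T (surgery r S) = T S"
    "surgery r S = inner_cut u v S \<union> vedges u v"
    "\<And>e. e \<in> S - surgery r S \<or> e \<in> surgery r S - S \<Longrightarrow> \<exists>x\<in>e. proj x = proj u"
proof -
  have bad: "bad S" using D unfolding ranked_def by blast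
  note b = bad_facts[OF bad uvd]
  let ?S = "inner_cut u v S"
  have sub: "?S \<subseteq> S" unfolding inner_cut_def by blast
  have uvp: "proj u = proj v" "v \<in> set (cmin S)" "u \<in> set (pmin r S)" using b(3) unfolding nearest_def by auto
  show eq: "surgery r S = ?S \<union> vedges u v" unfolding surgery_def uvd by simp
  have keep: "{x, y} \<in> ?S" if "{x, y} \<in> S" "x \<in> X" "y \<in> X" "X \<inter> vseg u v \<subseteq> {u, v}" for x y X
    using that unfolding inner_cut_def by blast
  have cS: "cedges (cmin S) \<subseteq> ?S"
  proof
    fix e assume e: "e \<in> cedges (cmin S)"
    then obtain x y where xy: "e = {x, y}" "x \<in> set (cmin S)" "y \<in> set (cmin S)" using cedges_in by blast
    show "e \<in> ?S" unfolding xy(1)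
      by (rule keep[where X = "set (cmin S)"]) (use e xy b(3,6) in \<open>auto simp: nearest_def\<close>)
  qed
  have lc: "is_least circ_lex (opens ?S) (cmin S)"
    by (rule is_least_subset[OF b(2)]) (use sub cS b(5) in \<open>auto simp: opens_def\<close>)
  have pS: "pmin r S \<in> paths ?S R (T S) L"
  proof (rule steps_unchanged[OF b(7)])
    fix x y assume xy: "(x, y) \<in> set (steps (pmin r S))"
    show "{x, y} \<in> ?S"
      by (rule keep[where X = "set (pmin r S)"])
        (use xy in_set_steps[OF xy] paths_steps[OF b(7) xy] b(3) in \<open>auto simp: nearest_def step_def\<close>)
  qed
  have lp: "is_least (pord r) (paths ?S R (T S) L) (pmin r S)"
    by (rule is_least_subset[OF b(1) paths_mono[OF sub] pS])
  have rS: "reach ?S R (T S) \<subseteq> reach S R (T S)" by (rule reach_mono[OF sub]) auto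
  have disj: "set (cmin S) \<inter> reach ?S R (T S) = {}" using rS bad unfolding bad_def by blast
  \<comment> \<open>\<open>v\<close> lies on the unreached circuit. An interior vertex is not in the
    target by \<open>off\<close>, so a path reaching it would end with an edge that the cut has
    closed.\<close>
  have sep: "vseg u v \<inter> reach ?S R (T S) \<subseteq> {u}"
  proof
    fix x assume x: "x \<in> vseg u v \<inter> reach ?S R (T S)"
    show "x \<in> {u}"
    proof (rule ccontr)
      assume "x \<notin> {u}"
      moreover have "x \<noteq> v" using x disj uvp(2) by blast
      ultimately have inner: "x \<in> vseg u v - {u, v}" using x by blast
      obtain ps where ps: "walk ?S R ps" "hd ps \<in> T S" "last ps = x" using x unfolding reach_def by blast
      have "x \<notin> T S" using off[OF b(5) uvp(2), of x S] x uvp(1) unfolding vseg_def by auto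
      then have "ps \<noteq> [x]" using ps(2) by auto
      moreover have "ps \<noteq> []" using ps(1) unfolding walk_def by blast
      ultimately obtain qs z where "ps = qs @ [z, x]" using ps(3)
        by (metis append_butlast_last_id append_Cons append_Nil append_assoc)
      then have "{z, x} \<in> ?S" using ps(1) unfolding walk_def step_def by (auto simp: successively_append_iff)
      then show False using inner unfolding inner_cut_def by blast
    qed
  qed
  have rank: "\<exists>xs y ys. pmin r S = xs @ u # y # ys \<and> lvl r u y < lvl r u (nxtv u v)"
    using D unfolding ranked_def uvd by simp
  show "good r (T S) ?S (cmin S) (pmin r S) u v"
    unfolding good_def using lc lp disj uvp sep rank by blast
  show ch: "\<exists>x\<in>e. proj x = proj u" if "e \<in> S - surgery r S \<or> e \<in> surgery r S - S" for e
  proof -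
    from that have "e \<inter> vseg u v \<noteq> {}"
      unfolding eq inner_cut_def vedges_def by blast
    then show ?thesis unfolding vseg_def by blast
  qed
  have "\<And>e. e \<in> S - surgery r S \<union> (surgery r S - S) \<Longrightarrow> \<exists>x\<in>e. proj x = proj v"
    using ch unfolding uvp(1) by blast
  from T_local[OF b(5) uvp(2) this] show "T (surgery r S) = T S" by simp
qed

definition glued :: "edge set \<Rightarrow> bool" where
  "glued S \<longleftrightarrow> opens S \<noteq> {} \<and> conn S R (T S) (set (cmin S))"

text \<open>The minimal circuit may change when the bridge is opened. If the new one avoids the
  bridge edges, it is open after the cut and equals the old one, which contains \<open>v\<close>;
  otherwise it has a vertex on the bridge. Either way it is reached.\<close>

lemma surgery_glued:
  assumes D: "ranked r S" and S: "S \<subseteq> F"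
  shows "surgery r S \<subseteq> F \<and> glued (surgery r S)"
proof -
  obtain u v where uvd: "uv r S = (u, v)" by (cases "uv r S")
  note s = surgery_facts[OF D uvd]
  note g = good_facts[OF s(1)]
  let ?S = "inner_cut u v S" and ?S' = "surgery r S"
  have sub: "?S \<subseteq> ?S'" "vedges u v \<subseteq> ?S'" unfolding s(3) by auto
  have "?S' \<subseteq> F"
    using S R_edges g(7) unfolding s(3) inner_cut_def vedges_def by blast
  moreover have cS': "cmin S \<in> opens ?S'" using g(1,2) sub unfolding opens_def by blast
  moreover have "reach ?S' R (T S) \<inter> set (cmin ?S') \<noteq> {}"
  proof -
    have "u \<in> reach ?S' R (T S)" using g(5) reach_mono[OF sub(1)] by blast
    then have seg: "vseg u v \<subseteq> reach ?S' R (T S)" using vseg_reach sub(2) g(7) by blast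
    have least: "is_least circ_lex (opens ?S') (cmin ?S')" using cmin cS' by blast
    then have c': "cmin ?S' \<in> Fam" "cedges (cmin ?S') \<subseteq> ?S'" unfolding is_least_def opens_def by auto
    show ?thesis
    proof (cases "cedges (cmin ?S') \<inter> vedges u v = {}")
      case True
      then have "cmin ?S' \<in> opens ?S" using c' unfolding s(3) opens_def by blast
      then have "cmin ?S' = cmin S"
        using least_both[OF least _ _ cS' circ_lex_order(1,2)] s(1) unfolding good_def by blast
      moreover have "v \<in> vseg u v" using s(1) vseg_ends unfolding good_def by blast
      ultimately show ?thesis using seg s(1) unfolding good_def by auto
    next
      case False
      then obtain e where e: "e \<in> cedges (cmin ?S')" "e \<in> vedges u v" by blast
      obtain x y where xy: "e = {x, y}" "x \<in> set (cmin ?S')" using cedges_in[OF e(1)] by blast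
      then show ?thesis using in_vedges[of x y u v] e(2) seg by blast
    qed
  qed
  ultimately show ?thesis unfolding glued_def conn_iff_reach s(2) by blast
qed

section \<open>Cost of the surgery and average over the bits\<close>

definition touching :: "int \<times> int \<Rightarrow> edge set" where
  "touching z = {e \<in> F. \<exists>x\<in>e. proj x = z}"

lemma card_touching: "card (touching z) \<le> 6 * (k + 1)"
proof -
  define dirs where "dirs = {(1::int, 0::int, 0::int), (-1, 0, 0), (0, 1, 0), (0, -1, 0), (0, 0, 1), (0, 0, -1)}"
  define f :: "int \<times> int \<times> int \<times> int \<Rightarrow> edge" where
    "f = (\<lambda>(h, (a, b, c)). {(fst z, snd z, h), (fst z + a, snd z + b, h + c)})"
  have "touching z \<subseteq> f ` ({0..int k} \<times> dirs)"
  proof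
    fix e assume e: "e \<in> touching z"
    then have "e \<in> edges k" using F_edges unfolding touching_def by blast
    then obtain x0 y0 where xy0: "e = {x0, y0}" "x0 \<in> slab k" "y0 \<in> slab k" "adj x0 y0"
      unfolding edges_def by blast
    have "proj x0 = z \<or> proj y0 = z" using e xy0(1) unfolding touching_def by blast
    then obtain x y where xy: "e = {x, y}" "x \<in> slab k" "y \<in> slab k" "adj x y" "proj x = z"
      using xy0 adj_commute[of x0 y0] insert_commute[of x0 y0] by metis
    obtain a b c a' b' c' where v: "x = (a, b, c)" "y = (a', b', c')" by (metis prod_cases3)
    have z: "fst z = a" "snd z = b" using xy(5) v by (auto simp: proj_def)
    define i j l where ijl: "i = a' - a" "j = b' - b" "l = c' - c"
    have "\<bar>i\<bar> + \<bar>j\<bar> + \<bar>l\<bar> = 1"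
      using xy(4) unfolding v adj_def ijl by (simp add: abs_minus_commute)
    then have "j = 0 \<and> l = 0 \<and> (i = 1 \<or> i = -1) \<or> i = 0 \<and> l = 0 \<and> (j = 1 \<or> j = -1)
        \<or> i = 0 \<and> j = 0 \<and> (l = 1 \<or> l = -1)"
      by arith
    then have "(a' - a, b' - b, c' - c) \<in> dirs"
      unfolding dirs_def ijl[symmetric] by auto
    moreover have "c \<in> {0..int k}" using xy(2) unfolding v slab_def by simp
    moreover have "e = f (c, (a' - a, b' - b, c' - c))" unfolding f_def xy(1) v using z by simp
    ultimately show "e \<in> f ` ({0..int k} \<times> dirs)" by blast
  qed
  moreover have fin: "finite ({0..int k} \<times> dirs)" unfolding dirs_def by simp
  ultimately have "card (touching z) \<le> card ({0..int k} \<times> dirs)"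
    by (meson card_image_le card_mono finite_imageI le_trans)
  also have "\<dots> = (k + 1) * card dirs" by (simp add: card_cartesian_product nat_add_distrib)
  also have "card dirs = 6" unfolding dirs_def by simp
  finally show ?thesis by (simp add: mult.commute)
qed

text \<open>The set of edges declared as changed is everything touching the column: it contains the
  edges really changed and, unlike them, depends on the column alone.\<close>

lemma prob_ranked:
  assumes "0 < \<epsilon>" "\<epsilon> \<le> p" "p \<le> 1 - \<epsilon>"
  shows "bern p F (ranked r) \<le> (2 / \<epsilon>) ^ (6 * (k + 1)) * bern p F glued"
proof (rule finite_energy[OF finF assms, where \<Phi> = "surgery r" and N = "\<lambda>S. touching (proj (fst (uv r S)))"])
  fix S assume S: "S \<subseteq> F" "ranked r S"
  show "surgery r S \<subseteq> F \<and> glued (surgery r S)" using surgery_glued S by blast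
  obtain u v where uvd: "uv r S = (u, v)" by (cases "uv r S")
  have "S - touching (proj u) = surgery r S - touching (proj u)"
    using surgery_facts(4)[OF S(2) uvd] S(1) surgery_glued[OF S(2,1)] unfolding touching_def by blast
  then show "touching (proj (fst (uv r S))) \<subseteq> F \<and> card (touching (proj (fst (uv r S)))) \<le> 6 * (k + 1) \<and>
      S - touching (proj (fst (uv r S))) = surgery r S - touching (proj (fst (uv r S)))"
    using card_touching uvd by (auto simp: touching_def)
next
  fix S S' assume S: "ranked r S" "ranked r S'" "surgery r S = surgery r S'"
  obtain u v where uvd: "uv r S = (u, v)" by (cases "uv r S")
  obtain u' v' where uvd': "uv r S' = (u', v')" by (cases "uv r S'")
  note s = surgery_facts[OF S(1) uvd] and s' = surgery_facts[OF S(2) uvd']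
  have TT: "T S = T S'" using s(2) s'(2) S(3) by simp
  have "proj u = proj u'"
    using column_unique[OF s(1)[unfolded TT] s'(1) TL] s(3) s'(3) S(3) by simp
  then show "touching (proj (fst (uv r S))) = touching (proj (fst (uv r S')))" using uvd uvd' by simp
qed

text \<open>Toggling the bit at \<open>u\<close> sends unranked bit sets to ranked ones. The least
  path is unchanged, so \<open>u\<close> can be read off from the image, and toggling is an
  involution; hence the map is injective.\<close>

lemma half_ranked:
  assumes "bad S"
  shows "card {r \<in> Pow R. \<not> ranked r S} \<le> card {r \<in> Pow R. ranked r S}"
proof -
  define toggle :: "vtx \<Rightarrow> vtx set \<Rightarrow> vtx set" where
    "toggle u r = (if u \<in> r then r - {u} else insert u r)" for u r
  have toggle2: "toggle u (toggle u r) = r" for u r unfolding toggle_def by auto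
  define f where "f r = toggle (fst (uv r S)) r" for r
  have key: "pmin (f r) S = pmin r S \<and> ranked (f r) S \<and> f r \<in> Pow R"
    if r: "r \<in> Pow R" "\<not> ranked r S" for r
  proof -
    obtain u v where uvd: "uv r S = (u, v)" by (cases "uv r S")
    note b = bad_facts[OF assms uvd]
    obtain xs y ys where \<pi>: "pmin r S = xs @ u # y # ys" using b(9) by blast
    have notlt: "\<not> lvl r u y < lvl r u (nxtv u v)"
      using r(2) assms \<pi> unfolding ranked_def uvd fst_conv snd_conv by blast
    \<comment> \<open>The path cannot leave \<open>u\<close> along the bridge: the next bridge
      vertex would be a path vertex on the segment, hence \<open>v\<close>, which is not
      reached.\<close>
    have y: "y \<noteq> nxtv u v"
    proof
      assume y: "y = nxtv u v"
      have "proj u = proj v" using b(3) unfolding nearest_def by blast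
      then have "nxtv u v \<in> vseg u v" using b(4) unfolding vseg_def by (auto simp: sgn_if)
      then have "y \<in> {u, v}" using b(3) \<pi> y unfolding nearest_def by auto
      moreover have "y \<noteq> u" using y b(4) by (metis add.right_neutral add_left_cancel nxtv_simps(2) right_minus_eq sgn_0_0)
      moreover have "y \<noteq> v" using b(3,8) assms \<pi> unfolding bad_def nearest_def by auto
      ultimately show False by blast
    qed
    have fr: "f r = (if u \<in> r then r - {u} else insert u r)" unfolding f_def toggle_def uvd by simp
    note fl = least_path_flip[OF b(1) \<pi> b(4) y notlt fr]
    have same: "pmin (f r) S = pmin r S" by (rule pmin_eqI[OF fl(1)])
    then have uvf: "uv (f r) S = (u, v)" using uvd unfolding uv_def by simp
    have "ranked (f r) S" unfolding ranked_def uvf fst_conv snd_conv same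
      by (intro conjI assms exI[of _ xs] exI[of _ y] exI[of _ ys] \<pi> fl(2))
    moreover have "u \<in> set (pmin r S)" using b(3) unfolding nearest_def by blast
    then have "u \<in> R" using b(8) reach_subset by blast
    ultimately show ?thesis using same r(1) fr by auto
  qed
  have "inj_on f {r \<in> Pow R. \<not> ranked r S}"
  proof (rule inj_onI)
    fix r r' assume r: "r \<in> {r \<in> Pow R. \<not> ranked r S}" "r' \<in> {r \<in> Pow R. \<not> ranked r S}" "f r = f r'"
    have "pmin r S = pmin r' S" using key[of r] key[of r'] r by auto
    then have "uv r S = uv r' S" unfolding uv_def by simp
    then have "toggle (fst (uv r S)) (toggle (fst (uv r S)) r) = toggle (fst (uv r S)) (toggle (fst (uv r S)) r')"
      using r(3) unfolding f_def by simp
    then show "r = r'" unfolding toggle2 .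
  qed
  moreover have "f ` {r \<in> Pow R. \<not> ranked r S} \<subseteq> {r \<in> Pow R. ranked r S}" using key by blast
  ultimately show ?thesis using finR by (intro card_inj_on_le[of f]) auto
qed

text \<open>The summand 1 covers configurations already glued, the factor 2 is lost in averaging
  over the bits, and the power is the cost of altering one column.\<close>

theorem gluing:
  assumes \<epsilon>: "0 < \<epsilon>" "\<epsilon> \<le> p" "p \<le> 1 - \<epsilon>"
  shows "bern p F (\<lambda>S. opens S \<noteq> {} \<and> conn S R (T S) L) \<le>
    (1 + 2 * (2 / \<epsilon>) ^ (6 * (k + 1))) * bern p F glued"
proof -
  have p: "0 \<le> p" "p \<le> 1" using \<epsilon> by auto
  have "bern p F (\<lambda>S. opens S \<noteq> {} \<and> conn S R (T S) L) \<le> bern p F (\<lambda>S. glued S \<or> bad S)"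
    by (rule bern_mono[OF p]) (auto simp: glued_def bad_def conn_iff_reach)
  also have "\<dots> \<le> bern p F glued + bern p F bad" by (rule bern_disj_le[OF p])
  also have "bern p F bad \<le> 2 * ((2 / \<epsilon>) ^ (6 * (k + 1)) * bern p F glued)"
    by (rule bern_le_of_half[OF finF p finR, where D = ranked])
      (use prob_ranked[OF \<epsilon>] half_ranked in auto)
  finally show ?thesis by (simp add: algebra_simps)
qed

end

section \<open>Winding numbers and circuits\<close>

text \<open>Two arguments of absolute value below pi/2 have a sum inside the principal
  range.\<close>

lemma Arg_mult_pos:
  assumes "0 < Re z" "0 < Re w"
  shows "Arg (z * w) = Arg z + Arg w"
proof -
  have nz: "z \<noteq> 0" "w \<noteq> 0" using assms by auto
  have "\<bar>Im (Ln z)\<bar> < pi / 2" "\<bar>Im (Ln w)\<bar> < pi / 2"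
    using assms nz Re_Ln_pos_lt by blast+
  then have "Ln (z * w) = Ln z + Ln w" using nz by (intro Ln_times_simple) linarith+
  then show ?thesis using nz by (simp add: Arg_eq_Im_Ln)
qed

text \<open>Equality is allowed, since a vertical step of the slab projects to a single
  point.\<close>

definition near :: "int \<times> int \<Rightarrow> int \<times> int \<Rightarrow> bool" where
  "near a b \<longleftrightarrow> \<bar>fst a - fst b\<bar> + \<bar>snd a - snd b\<bar> \<le> 1"

text \<open>Its argument is the angle increment from \<open>a\<close> to \<open>b\<close> seen from
  \<open>x\<close>, the summand of \<open>winding\<close>.\<close>

definition rel :: "int \<times> int \<Rightarrow> int \<times> int \<Rightarrow> int \<times> int \<Rightarrow> complex" where
  "rel x a b = (cpt b - cpt x) / (cpt a - cpt x)"

lemma cpt_eq_iff [simp]: "cpt a = cpt b \<longleftrightarrow> a = b"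
  by (auto simp: cpt_def complex_eq_iff prod_eq_iff)

text \<open>
  Neighbouring lattice points are seen from any third one under an angle less than $\pi/2$, so
  arguments add without branch correction.
\<close>

lemma near_inner_pos:
  fixes s1 s2 t1 t2 :: int
  assumes "(s1, s2) \<noteq> (0, 0)" "(t1, t2) \<noteq> (0, 0)" "\<bar>s1 - t1\<bar> + \<bar>s2 - t2\<bar> \<le> 1"
  shows "0 < s1 * t1 + s2 * t2"
proof -
  \<comment> \<open>Integers at distance at most 1 never have opposite signs; a coordinate in which
    both vectors are nonzero then makes the inner product positive.\<close>
  have pos: "0 \<le> s * t \<and> (s \<noteq> 0 \<longrightarrow> t \<noteq> 0 \<longrightarrow> 0 < s * t)" if "\<bar>s - t\<bar> \<le> 1" for s t :: int
  proof -
    have "s = 0 \<or> t = 0 \<or> 0 < s \<and> 0 < t \<or> s < 0 \<and> t < 0" using that by arith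
    then show ?thesis by (auto simp: mult_pos_pos mult_neg_neg mult_nonpos_nonpos)
  qed
  have "s1 = t1 \<or> s2 = t2" using assms(3) by linarith
  then have "(s1 \<noteq> 0 \<and> t1 \<noteq> 0) \<or> (s2 \<noteq> 0 \<and> t2 \<noteq> 0)" using assms(1,2) by auto
  moreover have "0 \<le> s1 * t1 \<and> (s1 \<noteq> 0 \<longrightarrow> t1 \<noteq> 0 \<longrightarrow> 0 < s1 * t1)"
    "0 \<le> s2 * t2 \<and> (s2 \<noteq> 0 \<longrightarrow> t2 \<noteq> 0 \<longrightarrow> 0 < s2 * t2)"
    using assms(3) by (intro pos; linarith)+
  ultimately show ?thesis by linarith
qed

lemma Re_rel_pos:
  assumes "a \<noteq> x" "b \<noteq> x" "near a b"
  shows "0 < Re (rel x a b)"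
proof -
  define s1 s2 t1 t2 where st: "s1 = fst a - fst x" "s2 = snd a - snd x" "t1 = fst b - fst x" "t2 = snd b - snd x"
  have "(s1, s2) \<noteq> (0, 0)" "(t1, t2) \<noteq> (0, 0)"
    using assms(1,2) unfolding st by (auto simp: prod_eq_iff)
  then have "0 < s1 * t1 + s2 * t2"
    by (rule near_inner_pos) (use assms(3) in \<open>simp add: st near_def\<close>)
  then have p: "0 < real_of_int (t1 * s1 + t2 * s2)"
    unfolding of_int_0_less_iff by (simp add: mult.commute)
  have "cpt b - cpt x = Complex t1 t2" "cpt a - cpt x = Complex s1 s2"
    by (auto simp: cpt_def st complex_eq_iff)
  moreover have "0 < (real_of_int s1)\<^sup>2 + (real_of_int s2)\<^sup>2"
    using \<open>(s1, s2) \<noteq> (0, 0)\<close> by (simp add: sum_power2_gt_zero_iff)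
  ultimately show ?thesis
    using p unfolding rel_def by (simp add: Re_divide)
qed

lemma winding_steps:
  "winding c x = (\<Sum>(a, b)\<leftarrow>steps c. Arg (rel x (proj a) (proj b))) / (2 * pi)"
proof -
  have "(\<Sum>i<length c - 1. f (c ! i) (c ! (i + 1))) = (\<Sum>(a, b)\<leftarrow>steps c. f a b)"
    for f :: "vtx \<Rightarrow> vtx \<Rightarrow> real"
  proof (induction c rule: remdups_adj.induct)
    case (3 a b c)
    have "(\<Sum>i<length (b # c) - 1. f ((b # c) ! i) ((b # c) ! (i + 1))) = (\<Sum>(a, b)\<leftarrow>steps (b # c). f a b)"
      using 3 by (cases "a = b") auto
    then show ?case by (simp add: sum.lessThan_Suc_shift del: sum.lessThan_Suc)
  qed auto
  from this[of "\<lambda>a b. Arg (rel x (proj a) (proj b))"] show ?thesis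
    unfolding winding_def rel_def by simp
qed

lemma adj_near: "adj x y \<Longrightarrow> near (proj x) (proj y)"
  by (cases x; cases y) (auto simp: adj_def near_def proj_def)

lemma sum_steps_telescope:
  fixes g :: "'a \<Rightarrow> real"
  assumes "c \<noteq> []"
  shows "(\<Sum>(a, b)\<leftarrow>steps c. g b - g a) = g (last c) - g (hd c)"
  using assms by (induction c rule: induct_list012) auto

lemma is_circuit_iff:
  "is_circuit k c \<longleftrightarrow> 2 \<le> length c \<and> hd c = last c \<and> distinct (butlast c) \<and> set c \<subseteq> slab k \<and>
    (\<forall>(a, b)\<in>set (steps c). adj a b)"
proof (cases c)
  case (Cons a c')
  then show ?thesis
    unfolding is_circuit_def successively_iff_steps[symmetric] successively_iff_nth
    by (simp add: last_conv_nth)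
qed (simp add: is_circuit_def)

lemma sum_list_steps_cong:
  assumes "\<And>a b. (a, b) \<in> set (steps c) \<Longrightarrow> f a b = g a b"
  shows "(\<Sum>(a, b)\<leftarrow>steps c. f a b) = (\<Sum>(a, b)\<leftarrow>steps c. (g a b :: real))"
  using assms by (intro arg_cong[where f = sum_list] map_cong) auto

text \<open>Replacing the centre \<open>w\<close> by \<open>w'\<close> changes the increment of a
  step by \<open>g b - g a\<close>, where \<open>g a\<close> is the angle from \<open>w'\<close> to
  \<open>w\<close> seen from \<open>a\<close>. Over a closed circuit these corrections
  cancel.\<close>

lemma winding_near:
  assumes c: "is_circuit k c" and w: "near w w'" "w \<notin> proj ` set c" "w' \<notin> proj ` set c"
  shows "winding c w = winding c w'"
proof -
  define g where "g a = Arg (rel (proj a) w' w)" for a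
  have eq: "Arg (rel w (proj a) (proj b)) = Arg (rel w' (proj a) (proj b)) + (g b - g a)"
    if ab: "(a, b) \<in> set (steps c)" for a b
  proof -
    have "near (proj a) (proj b)" using ab c adj_near unfolding is_circuit_iff by blast
    moreover have ne: "proj a \<noteq> w" "proj b \<noteq> w" "proj a \<noteq> w'" "proj b \<noteq> w'"
      using in_set_steps[OF ab] w(2,3) by auto
    moreover have "near w' w" using w(1) unfolding near_def by (simp add: abs_minus_commute)
    ultimately have pos: "0 < Re (rel w (proj a) (proj b))" "0 < Re (rel w' (proj a) (proj b))"
      "0 < Re (rel (proj a) w' w)" "0 < Re (rel (proj b) w' w)"
      by (auto intro!: Re_rel_pos)
    have nz: "cpt (proj a) - cpt w \<noteq> 0" "cpt (proj b) - cpt w \<noteq> 0" "cpt (proj a) - cpt w' \<noteq> 0"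
      "cpt (proj b) - cpt w' \<noteq> 0" using ne by auto
    have flip: "rel z w' w = (cpt z - cpt w) / (cpt z - cpt w')" for z
      unfolding rel_def by (metis minus_diff_eq minus_divide_divide)
    \<comment> \<open>After cancellation both sides are the quotient of \<open>b - w\<close> by
      \<open>a - w'\<close>.\<close>
    have "rel w (proj a) (proj b) * rel (proj a) w' w = rel w' (proj a) (proj b) * rel (proj b) w' w"
      unfolding flip unfolding rel_def using nz by simp
    then have "Arg (rel w (proj a) (proj b)) + g a = Arg (rel w' (proj a) (proj b)) + g b"
      unfolding g_def using Arg_mult_pos pos by metis
    then show ?thesis by simp
  qed
  have "c \<noteq> []" "hd c = last c" using c unfolding is_circuit_iff by auto
  then have "(\<Sum>(a, b)\<leftarrow>steps c. g b - g a) = 0" by (simp add: sum_steps_telescope)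
  moreover have "(\<Sum>(a, b)\<leftarrow>steps c. Arg (rel w (proj a) (proj b)))
      = (\<Sum>(a, b)\<leftarrow>steps c. Arg (rel w' (proj a) (proj b)) + (g b - g a))"
    using eq by (rule sum_list_steps_cong)
  moreover have "\<dots> = (\<Sum>(a, b)\<leftarrow>steps c. Arg (rel w' (proj a) (proj b))) + (\<Sum>(a, b)\<leftarrow>steps c. g b - g a)"
    by (simp add: case_prod_unfold sum_list_addf)
  ultimately show ?thesis unfolding winding_steps by simp
qed

text \<open>Seen from \<open>w\<close> the circuit stays in an open half-plane, turned into the
  right one by the sign \<open>s\<close>. There the argument is a single-valued function, so the
  increments telescope to 0.\<close>

lemma winding_outside:
  assumes c: "is_circuit k c" and w: "(\<forall>v\<in>set c. fst (proj v) < fst w) \<or> (\<forall>v\<in>set c. fst w < fst (proj v))"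
  shows "winding c w = 0"
proof -
  obtain s :: real where s: "s \<noteq> 0" "\<And>v. v \<in> set c \<Longrightarrow> 0 < Re (s * (cpt (proj v) - cpt w))"
  proof (cases "\<forall>v\<in>set c. fst w < fst (proj v)")
    case True
    then show ?thesis by (intro that[of 1]) (auto simp: cpt_def)
  next
    case False
    then show ?thesis using w by (intro that[of "-1"]) (auto simp: cpt_def)
  qed
  define g where "g v = Arg (s * (cpt (proj v) - cpt w))" for v
  have "Arg (rel w (proj a) (proj b)) = g b - g a" if ab: "(a, b) \<in> set (steps c)" for a b
  proof -
    have v: "a \<in> set c" "b \<in> set c" using in_set_steps[OF ab] by auto
    then have ne: "proj a \<noteq> w" "proj b \<noteq> w" using w by auto
    have "near (proj a) (proj b)" using ab c adj_near unfolding is_circuit_iff by blast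
    then have pos: "0 < Re (rel w (proj a) (proj b))" using Re_rel_pos ne by blast
    have eq: "rel w (proj a) (proj b) * (s * (cpt (proj a) - cpt w)) = s * (cpt (proj b) - cpt w)"
      unfolding rel_def using ne by simp
    show ?thesis unfolding g_def using Arg_mult_pos[OF pos s(2)[OF v(1)]] unfolding eq by simp
  qed
  then have "(\<Sum>(a, b)\<leftarrow>steps c. Arg (rel w (proj a) (proj b))) = (\<Sum>(a, b)\<leftarrow>steps c. g b - g a)"
    by (rule sum_list_steps_cong)
  moreover have "c \<noteq> []" "hd c = last c" using c unfolding is_circuit_iff by auto
  ultimately show ?thesis unfolding winding_steps by (simp add: sum_steps_telescope)
qed

lemma winding_walk:
  assumes c: "is_circuit k c" and ps: "walk S X ps" "proj ` set ps \<inter> proj ` set c = {}"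
  shows "winding c (proj (hd ps)) = winding c (proj (last ps))"
  using ps
proof (induction ps rule: induct_list012)
  case (3 p q ps)
  have "walk S X (q # ps)" "step S p q" using "3.prems"(1) unfolding walk_def by auto
  moreover have "winding c (proj p) = winding c (proj q)"
    by (rule winding_near[OF c adj_near])
      (use "3.prems"(2) \<open>step S p q\<close> in \<open>auto simp: step_def\<close>)
  ultimately show ?case using "3.IH"(2) "3.prems"(2) by auto
qed (auto simp: walk_def)

lemma winding_Box:
  assumes c: "is_circuit k c" "set c \<subseteq> ovl k (Ann m n x)" and "\<bar>s\<bar> = 1" "int j \<le> m"
  shows "winding c (fst x, snd x + s * int j) = winding c x"
  using assms(4)
proof (induction j)
  case (Suc j)
  have off: "w \<notin> proj ` set c" if "w \<in> Box m x" for w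
    using that c(2) unfolding ovl_def Ann_def proj_def by auto
  have s: "\<bar>s * int i\<bar> = int i" for i using assms(3) by (simp add: abs_mult)
  have "winding c (fst x, snd x + s * int (Suc j)) = winding c (fst x, snd x + s * int j)"
  proof (rule winding_near[OF c(1)])
    show "near (fst x, snd x + s * int (Suc j)) (fst x, snd x + s * int j)"
      using assms(3) unfolding near_def by (simp add: distrib_left)
  qed (use s[of "Suc j"] s[of j] Suc.prems in \<open>auto simp: Box_def intro!: off\<close>)
  then show ?case using Suc by simp
qed simp

text \<open>A walk sharing no column with the circuit would carry the winding number unchanged from
  its start, where it is 0, to its end in the inner box, where it is not. Only the projections need
  to meet, possibly at different heights.\<close>

lemma circuit_meets_walk:
  assumes c: "is_circuit k c" "set c \<subseteq> ovl k (Ann m n x)" "surrounds c x" and ps: "walk S X ps"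
    and out: "(\<forall>v\<in>set c. fst (proj v) < fst (proj (hd ps))) \<or> (\<forall>v\<in>set c. fst (proj (hd ps)) < fst (proj v))"
    and inn: "fst (proj (last ps)) = fst x" "\<bar>snd (proj (last ps)) - snd x\<bar> \<le> m"
  shows "\<exists>p\<in>set ps. \<exists>v\<in>set c. proj p = proj v"
proof (rule ccontr)
  assume "\<not> ?thesis"
  then have "proj ` set ps \<inter> proj ` set c = {}" by blast
  then have "winding c (proj (last ps)) = 0"
    using winding_walk[OF c(1) ps] winding_outside[OF c(1) out] by simp
  moreover define d where "d = snd (proj (last ps)) - snd x"
  have "d = (if d < 0 then - 1 else 1) * int (nat \<bar>d\<bar>)" by auto
  then have "proj (last ps) = (fst x, snd x + (if d < 0 then - 1 else 1) * int (nat \<bar>d\<bar>))"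
    using inn(1) by (simp add: d_def prod_eq_iff)
  then have "winding c (proj (last ps)) = winding c x"
    using winding_Box[OF c(1,2), of "if d < 0 then - 1 else 1" "nat \<bar>d\<bar>"] inn(2) by (simp add: d_def)
  ultimately show False using c(3) unfolding surrounds_def by simp
qed

section \<open>Open circuits up to rotation and reversal\<close>

definition loop :: "nat \<Rightarrow> edge set \<Rightarrow> int \<Rightarrow> int \<Rightarrow> int \<times> int \<Rightarrow> vtx list \<Rightarrow> bool" where
  "loop k S m n x c \<longleftrightarrow> is_circuit k c \<and> cedges c \<subseteq> S \<and> set c \<subseteq> ovl k (Ann m n x) \<and> surrounds c x"

definition close_up :: "'a list \<Rightarrow> 'a list" where
  "close_up xs = xs @ [hd xs]"

lemma steps_close_up_rotate:
  assumes "ys \<noteq> []" "zs \<noteq> []"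
  shows "steps (close_up (ys @ zs)) = steps (ys @ [hd zs]) @ steps (zs @ [hd ys])"
proof -
  obtain z zs' where "zs = z # zs'" using assms(2) neq_Nil_conv[of zs] by blast
  then show ?thesis using steps_append[of ys z "zs' @ [hd ys]"] assms(1) by (simp add: close_up_def hd_append)
qed

lemma Collect_pair_image: "{f x y | x y. (x, y) \<in> A} = (\<lambda>(x, y). f x y) ` A"
  by (auto intro: rev_image_eqI)

lemma cedges_steps: "cedges c = (\<lambda>(x, y). {x, y}) ` set (steps c)"
  unfolding cedges_def by (rule Collect_pair_image)

lemma butlast_close_up: "butlast (close_up xs) = xs"
  unfolding close_up_def by simp

lemma set_close_up: "xs \<noteq> [] \<Longrightarrow> set (close_up xs) = set xs"
  unfolding close_up_def by (simp add: insert_absorb)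

lemma loop_rotate:
  assumes l: "loop k S m n x (close_up (ys @ zs))"
  shows "loop k S m n x (close_up (zs @ ys))"
proof (cases "ys = [] \<or> zs = []")
  case False
  then have eq: "steps (close_up (ys @ zs)) = steps (ys @ [hd zs]) @ steps (zs @ [hd ys])"
    "steps (close_up (zs @ ys)) = steps (zs @ [hd ys]) @ steps (ys @ [hd zs])"
    by (simp_all add: steps_close_up_rotate)
  then have w: "winding (close_up (zs @ ys)) x = winding (close_up (ys @ zs)) x"
    unfolding winding_steps by simp
  have st: "set (steps (close_up (zs @ ys))) = set (steps (close_up (ys @ zs)))" unfolding eq by auto
  have "set (close_up (zs @ ys)) = set (close_up (ys @ zs))" using False by (simp add: set_close_up Un_commute)
  moreover have "hd (close_up (zs @ ys)) = last (close_up (zs @ ys))" using False by (simp add: close_up_def)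
  moreover have "distinct (butlast (close_up (zs @ ys)))" "2 \<le> length (close_up (zs @ ys))"
    using l unfolding loop_def is_circuit_iff by (auto simp: butlast_close_up) (simp add: close_up_def)
  ultimately show ?thesis
    using l unfolding loop_def is_circuit_iff surrounds_def cedges_steps st w by blast
qed (use l in auto)

lemma steps_rev: "steps (rev c) = map prod.swap (rev (steps c))"
proof (induction c rule: induct_list012)
  case (3 x y zs)
  have "steps (rev (x # y # zs)) = steps (rev (y # zs)) @ [(y, x)]"
    using steps_append2[of "rev zs" y x "[]"] by simp
  then show ?case using 3 by simp
qed auto

lemma Arg_rel_swap:
  assumes "adj a b" "proj a \<noteq> x" "proj b \<noteq> x"
  shows "Arg (rel x (proj b) (proj a)) = - Arg (rel x (proj a) (proj b))"
proof -
  have pos: "0 < Re (rel x (proj b) (proj a))" "0 < Re (rel x (proj a) (proj b))"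
    using assms adj_commute[of a b] by (auto intro!: Re_rel_pos adj_near)
  have "rel x (proj b) (proj a) * rel x (proj a) (proj b) = 1"
    unfolding rel_def using assms by simp
  then have "Arg (rel x (proj b) (proj a)) + Arg (rel x (proj a) (proj b)) = Arg 1"
    using Arg_mult_pos[OF pos] by simp
  then show ?thesis by simp
qed

lemma circuit_close_up:
  assumes "is_circuit k c"
  shows "c = close_up (butlast c)" "butlast c \<noteq> []"
proof -
  have c: "hd c = last c" "2 \<le> length c" using assms unfolding is_circuit_iff by auto
  then obtain x y zs where xyz: "c = x # y # zs" by (cases c rule: remdups_adj.cases) auto
  then show "butlast c \<noteq> []" by simp
  have "c = butlast c @ [last c]" using xyz by (intro append_butlast_last_id[symmetric]) simp
  moreover have "hd (butlast c) = last c" using c(1) xyz by simp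
  ultimately show "c = close_up (butlast c)" unfolding close_up_def by simp
qed

text \<open>Reversal negates every angle increment and so the winding number. For
  \<open>0 \<le> m\<close> the annulus misses its centre, so all increments are defined by nonzero
  vectors.\<close>

lemma loop_rev:
  assumes l: "loop k S m n x c" and "0 \<le> m"
  shows "loop k S m n x (rev c)"
proof -
  have c: "is_circuit k c" "set c \<subseteq> ovl k (Ann m n x)" using l unfolding loop_def by auto
  have inv: "Arg (rel x (proj b) (proj a)) = - Arg (rel x (proj a) (proj b))"
    if ab: "(a, b) \<in> set (steps c)" for a b
  proof (rule Arg_rel_swap)
    show "adj a b" using ab c(1) unfolding is_circuit_iff by blast
    have "a \<in> ovl k (Ann m n x)" "b \<in> ovl k (Ann m n x)" using in_set_steps[OF ab] c(2) by auto
    then show "proj a \<noteq> x" "proj b \<noteq> x"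
      using \<open>0 \<le> m\<close> unfolding ovl_def Ann_def Box_def proj_def by auto
  qed
  have "(\<Sum>(a, b)\<leftarrow>steps (rev c). Arg (rel x (proj a) (proj b))) = (\<Sum>(a, b)\<leftarrow>steps c. Arg (rel x (proj b) (proj a)))"
    unfolding steps_rev rev_map[symmetric] by (simp add: o_def case_prod_unfold rev_map[symmetric] sum_list_rev)
  also have "\<dots> = (\<Sum>(a, b)\<leftarrow>steps c. - Arg (rel x (proj a) (proj b)))"
    by (rule sum_list_steps_cong[OF inv])
  also have "\<dots> = - (\<Sum>(a, b)\<leftarrow>steps c. Arg (rel x (proj a) (proj b)))"
    by (simp add: case_prod_unfold uminus_sum_list_map o_def)
  finally have w: "winding (rev c) x = - winding c x" unfolding winding_steps by simp
  have "(\<lambda>(x, y). {x, y}) \<circ> prod.swap = (\<lambda>(x, y). {x, y :: vtx})" by (auto simp: insert_commute)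
  then have ce: "cedges (rev c) = cedges c"
    unfolding cedges_steps steps_rev set_map set_rev image_comp by (rule arg_cong)
  obtain xs where xs: "c = close_up xs" "xs \<noteq> []" using circuit_close_up[OF c(1)] by metis
  obtain y ys where y: "xs = y # ys" using xs(2) neq_Nil_conv[of xs] by blast
  have r: "rev c = close_up (y # rev ys)" unfolding xs(1) y close_up_def by simp
  have "distinct xs" using c(1) unfolding is_circuit_iff xs(1) close_up_def by simp
  then have "distinct (butlast (rev c))" unfolding r y close_up_def by simp
  moreover have "hd (rev c) = last (rev c)" unfolding r close_up_def by simp
  moreover have "\<forall>(a, b)\<in>set (steps (rev c)). adj a b"
    using c(1) adj_commute unfolding steps_rev is_circuit_iff by fastforce
  ultimately have "is_circuit k (rev c)" using c(1) unfolding is_circuit_iff by simp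
  then show ?thesis using l w ce unfolding loop_def surrounds_def by simp
qed

lemma normalized_iff:
  assumes "ws \<noteq> []"
  shows "normalized (v # ws @ [v]) \<longleftrightarrow> (\<forall>w\<in>set ws. vprec v w) \<and> vprec (hd ws) (last ws)"
proof -
  let ?c = "v # ws @ [v]"
  have "?c ! 1 = hd ws" using assms by (cases ws) auto
  moreover have "?c ! (length ?c - 2) = last ws"
    using assms by (cases ws rule: rev_cases) (auto simp: nth_append)
  moreover have "(\<forall>i. 0 < i \<and> i < length ?c - 1 \<longrightarrow> vprec (?c ! 0) (?c ! i)) \<longleftrightarrow> (\<forall>i<length ws. vprec v (ws ! i))"
  proof (intro iffI allI impI)
    fix i assume *: "\<forall>i. 0 < i \<and> i < length ?c - 1 \<longrightarrow> vprec (?c ! 0) (?c ! i)" and i: "i < length ws"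
    show "vprec v (ws ! i)" using *[rule_format, of "Suc i"] i by (simp add: nth_append)
  next
    fix i assume *: "\<forall>i<length ws. vprec v (ws ! i)" and i: "0 < i \<and> i < length ?c - 1"
    then show "vprec (?c ! 0) (?c ! i)" by (cases i) (auto simp: nth_append)
  qed
  ultimately show ?thesis unfolding normalized_def all_set_conv_all_nth by simp
qed

text \<open>Rotate the least vertex to the front and reverse if the second vertex does not precede
  the penultimate one.\<close>

lemma loop_normalized:
  assumes l: "loop k S m n x c" and m: "0 \<le> m"
  shows "\<exists>c'. loop k S m n x c' \<and> normalized c'"
proof -
  define xs where "xs = butlast c"
  have xs: "c = close_up xs" "xs \<noteq> []"
    using circuit_close_up l unfolding loop_def xs_def by blast+
  let ?r = "{(x, y). vprec x y}"
  have "trans ?r" using vprec_trans by (intro transI) blast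
  moreover have "total_on (set xs) ?r" using vprec_total unfolding total_on_def by simp
  ultimately obtain v where v: "is_least ?r (set xs) v"
    using is_least_exists[of "set xs" ?r] xs(2) by auto
  then obtain ys zs where yz: "xs = ys @ v # zs" unfolding is_least_def by (meson split_list)
  define ws where "ws = zs @ ys"
  define c2 where "c2 = v # ws @ [v]"
  have "loop k S m n x (close_up ((v # zs) @ ys))" using l loop_rotate unfolding xs(1) yz by blast
  then have l2: "loop k S m n x c2" unfolding c2_def ws_def close_up_def by simp
  have dist: "distinct (v # ws)" using l unfolding loop_def is_circuit_iff xs(1) butlast_close_up yz ws_def by auto
  have least: "\<forall>w\<in>set ws. vprec v w"
  proof
    fix w assume w: "w \<in> set ws"
    then have "w \<in> set xs" "w \<noteq> v" using dist unfolding ws_def yz by auto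
    then show "vprec v w" using v unfolding is_least_def by blast
  qed
  have c2: "is_circuit k c2" "set c2 \<subseteq> ovl k (Ann m n x)" "winding c2 x \<noteq> 0"
    using l2 unfolding loop_def surrounds_def by auto
  \<comment> \<open>Degenerate circuits have no normal form. A loop at \<open>v\<close> is not an
    edge, and running along one edge and back gives winding number 0.\<close>
  have two: "hd ws \<noteq> last ws \<and> ws \<noteq> []"
  proof (cases ws rule: remdups_adj.cases)
    case 1
    then have "adj v v" using c2(1) unfolding is_circuit_iff c2_def by simp
    then show ?thesis by (cases v) (simp add: adj_def)
  next
    case (2 w)
    have "adj v w" using c2(1) unfolding is_circuit_iff c2_def 2 by simp
    moreover have "proj v \<noteq> x" "proj w \<noteq> x"
      using c2(2) m unfolding c2_def 2 by (auto simp: ovl_def Ann_def Box_def proj_def)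
    ultimately have "Arg (rel x (proj w) (proj v)) = - Arg (rel x (proj v) (proj w))"
      by (rule Arg_rel_swap)
    then have "winding c2 x = 0" unfolding winding_steps c2_def 2 by simp
    then show ?thesis using c2(3) by simp
  next
    case (3 y z us)
    then show ?thesis using dist last_in_set[of "z # us"] by auto
  qed
  show ?thesis
  proof (cases "vprec (hd ws) (last ws)")
    case True
    then have "normalized c2" unfolding c2_def using normalized_iff two least by blast
    then show ?thesis using l2 by blast
  next
    case False
    then have "vprec (hd (rev ws)) (last (rev ws))"
      using two vprec_total by (metis hd_rev last_rev)
    then have "normalized (v # rev ws @ [v])"
      using normalized_iff[of "rev ws" v] two least by simp
    moreover have "rev c2 = v # rev ws @ [v]" unfolding c2_def by simp
    ultimately show ?thesis using loop_rev[OF l2 m] by metis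
  qed
qed

section \<open>Translations of the slab\<close>

definition shift :: "int \<times> int \<Rightarrow> vtx \<Rightarrow> vtx" where
  "shift d v = (fst v + fst d, fst (snd v) + snd d, snd (snd v))"

lemma shift_simps:
  "proj (shift d v) = (fst (proj v) + fst d, snd (proj v) + snd d)" "adj (shift d v) (shift d w) = adj v w"
  "shift d v \<in> slab k \<longleftrightarrow> v \<in> slab k"
  by (cases v; cases w; simp add: shift_def proj_def adj_def slab_def)+

lemma shift_inverse: "shift (- fst d, - snd d) (shift d v) = v" "shift d (shift (- fst d, - snd d) v) = v"
  by (cases v; simp add: shift_def)+

lemma inj_shift: "inj (shift d)"
  by (rule inj_on_inverseI[of _ "shift (- fst d, - snd d)"]) (simp add: shift_inverse)

lemma steps_map: "steps (map f c) = map (\<lambda>(a, b). (f a, f b)) (steps c)"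
  by (induction c rule: induct_list012) auto

lemma edge_shift_iff: "{shift d x, shift d y} \<in> (`) (shift d) ` S \<longleftrightarrow> {x, y} \<in> S"
proof -
  have "inj ((`) (shift d))" by (rule injI) (simp add: inj_image_eq_iff[OF inj_shift])
  moreover have "{shift d x, shift d y} = shift d ` {x, y}" by simp
  ultimately show ?thesis by (metis inj_image_mem_iff)
qed

lemma walk_shift: "walk S X ps \<Longrightarrow> walk ((`) (shift d) ` S) (shift d ` X) (map (shift d) ps)"
  unfolding walk_def step_def successively_map by (auto simp: shift_simps edge_shift_iff)

lemma conn_shift:
  "conn ((`) (shift d) ` S) (shift d ` X) (shift d ` A) (shift d ` B) \<longleftrightarrow> conn S X A B"
proof -
  have imp: "conn ((`) (shift d) ` S) (shift d ` X) (shift d ` A) (shift d ` B)" if con: "conn S X A B" for d S X A B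
  proof -
    obtain ps where ps: "walk S X ps" "hd ps \<in> A" "last ps \<in> B" using con unfolding conn_def by blast
    moreover have "ps \<noteq> []" using ps(1) unfolding walk_def by blast
    ultimately show ?thesis
      using walk_shift[OF ps(1)] unfolding conn_def
      by (intro exI[of _ "map (shift d) ps"]) (simp add: hd_map last_map)
  qed
  have inv: "shift (- fst d, - snd d) ` shift d ` Y = Y" for Y
    by (simp add: image_image shift_inverse)
  have inv2: "(`) (shift (- fst d, - snd d)) ` (`) (shift d) ` Y = Y" for Y
    by (simp add: image_image shift_inverse)
  show ?thesis
    using imp[of S X A B d] imp[of "(`) (shift d) ` S" "shift d ` X" "shift d ` A" "shift d ` B" "(- fst d, - snd d)"]
    unfolding inv inv2 by blast
qed

lemma loop_shift:
  assumes "loop k S m n x c"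
  shows "loop k ((`) (shift d) ` S) m n (fst x + fst d, snd x + snd d) (map (shift d) c)"
proof -
  let ?x = "(fst x + fst d, snd x + snd d)"
  have c: "is_circuit k c" "cedges c \<subseteq> S" "set c \<subseteq> ovl k (Ann m n x)" "surrounds c x"
    using assms unfolding loop_def by auto
  have "rel ?x (proj (shift d a)) (proj (shift d b)) = rel x (proj a) (proj b)" for a b
    unfolding rel_def shift_simps cpt_def by (simp add: complex_eq_iff Re_divide Im_divide)
  then have "winding (map (shift d) c) ?x = winding c x"
    unfolding winding_steps steps_map by (simp add: case_prod_unfold o_def)
  moreover have "cedges (map (shift d) c) \<subseteq> (`) (shift d) ` S"
  proof -
    have "cedges (map (shift d) c) = (`) (shift d) ` cedges c"
      unfolding cedges_steps steps_map by (auto simp: image_image case_prod_unfold)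
    then show ?thesis using c(2) by blast
  qed
  moreover have "is_circuit k (map (shift d) c)"
  proof -
    have "c \<noteq> []" using c(1) unfolding is_circuit_iff by auto
    moreover have "inj_on (shift d) (set (butlast c))" using inj_shift by (rule inj_on_subset) simp
    ultimately show ?thesis
      using c(1) unfolding is_circuit_iff steps_map
      by (auto simp: hd_map last_map map_butlast[symmetric] distinct_map shift_simps)
  qed
  moreover have "set (map (shift d) c) \<subseteq> ovl k (Ann m n ?x)"
  proof
    fix w assume "w \<in> set (map (shift d) c)"
    then obtain v where v: "w = shift d v" "v \<in> ovl k (Ann m n x)" using c(3) by auto
    then show "w \<in> ovl k (Ann m n ?x)"
      by (cases v; cases d) (auto simp: ovl_def Ann_def Box_def shift_def)
  qed
  ultimately show ?thesis using c(4) unfolding loop_def surrounds_def by simp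
qed

lemma loop_shift_iff:
  "(\<exists>c. loop k ((`) (shift d) ` S) m n (fst x + fst d, snd x + snd d) c) \<longleftrightarrow> (\<exists>c. loop k S m n x c)"
proof
  assume "\<exists>c. loop k ((`) (shift d) ` S) m n (fst x + fst d, snd x + snd d) c"
  then obtain c where c: "loop k ((`) (shift d) ` S) m n (fst x + fst d, snd x + snd d) c" by blast
  have "(`) (shift (- fst d, - snd d)) ` (`) (shift d) ` S = S"
    by (simp add: image_image shift_inverse)
  then show "\<exists>c. loop k S m n x c" using loop_shift[OF c, of "(- fst d, - snd d)"] by auto
qed (use loop_shift in blast)

section \<open>Two circuits and a crossing\<close>

definition edges_in :: "nat \<Rightarrow> vtx set \<Rightarrow> edge set" where
  "edges_in k V = {e \<in> edges k. e \<subseteq> V}"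

lemma edges_in_iff: "adj x y \<Longrightarrow> x \<in> slab k \<Longrightarrow> y \<in> slab k \<Longrightarrow> {x, y} \<in> edges_in k V \<longleftrightarrow> x \<in> V \<and> y \<in> V"
  unfolding edges_in_def edges_def by blast

lemma finite_edges_in: "finite V \<Longrightarrow> finite (edges_in k V)"
  unfolding edges_in_def by (rule finite_subset[of _ "Pow V"]) auto

lemma shift_edges: "e \<in> edges k \<Longrightarrow> shift d ` e \<in> edges k"
proof -
  assume "e \<in> edges k"
  then obtain x y where "e = {x, y}" "x \<in> slab k" "y \<in> slab k" "adj x y" unfolding edges_def by blast
  then have "shift d ` e = {shift d x, shift d y}" "shift d x \<in> slab k" "shift d y \<in> slab k"
    "adj (shift d x) (shift d y)" by (simp_all add: shift_simps)
  then show ?thesis unfolding edges_def by blast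
qed

lemma edges_in_shift: "(`) (shift d) ` edges_in k V = edges_in k (shift d ` V)"
proof
  show "(`) (shift d) ` edges_in k V \<subseteq> edges_in k (shift d ` V)"
    unfolding edges_in_def using shift_edges by blast
  show "edges_in k (shift d ` V) \<subseteq> (`) (shift d) ` edges_in k V"
  proof
    fix e assume e: "e \<in> edges_in k (shift d ` V)"
    let ?e = "shift (- fst d, - snd d) ` e"
    have "?e \<in> edges k" using e shift_edges unfolding edges_in_def by blast
    moreover have "?e \<subseteq> shift (- fst d, - snd d) ` shift d ` V" using e unfolding edges_in_def by blast
    then have "?e \<subseteq> V" by (simp add: image_image shift_inverse)
    moreover have "e = shift d ` ?e" by (simp add: image_image shift_inverse)
    ultimately show "e \<in> (`) (shift d) ` edges_in k V" unfolding edges_in_def by blast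
  qed
qed

text \<open>Has the form of the locality assumption \<open>dep\<close> of
  \<open>Pr_eq_bern\<close>.\<close>

lemma connects_restrict:
  assumes "X \<subseteq> V"
  shows "connects k \<omega> X A B \<longleftrightarrow> connects k (\<lambda>e. e \<in> edges_in k V \<and> \<omega> e) X A B"
proof -
  have "(adj (ps ! i) (ps ! (i + 1)) \<and> \<omega> {ps ! i, ps ! (i + 1)}) \<longleftrightarrow>
      (adj (ps ! i) (ps ! (i + 1)) \<and> {ps ! i, ps ! (i + 1)} \<in> edges_in k V \<and> \<omega> {ps ! i, ps ! (i + 1)})"
    if "set ps \<subseteq> X" "set ps \<subseteq> slab k" "i < length ps - 1" for ps i
  proof -
    have "ps ! i \<in> set ps" "ps ! (i + 1) \<in> set ps" using that(3) by auto
    then have "ps ! i \<in> slab k" "ps ! (i + 1) \<in> slab k" "ps ! i \<in> V" "ps ! (i + 1) \<in> V"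
      using that(1,2) assms by auto
    then show ?thesis using edges_in_iff[of "ps ! i" "ps ! (i + 1)" k V] by blast
  qed
  then show ?thesis unfolding connects_def by blast
qed

lemma open_circuit_iff: "open_circuit (\<lambda>e. e \<in> S) c \<longleftrightarrow> cedges c \<subseteq> S"
proof -
  have "open_circuit (\<lambda>e. e \<in> S) c \<longleftrightarrow> successively (\<lambda>x y. {x, y} \<in> S) c"
    unfolding open_circuit_def successively_iff_nth ..
  then show ?thesis unfolding successively_iff_steps cedges_steps by auto
qed

lemma open_circuit_restrict:
  assumes "is_circuit k c" "set c \<subseteq> V"
  shows "open_circuit \<omega> c \<longleftrightarrow> open_circuit (\<lambda>e. e \<in> edges_in k V \<and> \<omega> e) c"
proof -
  have "{c ! i, c ! (i + 1)} \<in> edges_in k V" if "i < length c - 1" for i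
  proof -
    have "c ! i \<in> set c" "c ! (i + 1) \<in> set c" using that by auto
    moreover have "adj (c ! i) (c ! (i + 1))" "set c \<subseteq> slab k" using that assms(1) unfolding is_circuit_def by auto
    ultimately show ?thesis using assms(2) edges_in_iff[of "c ! i" "c ! (i + 1)" k V] by blast
  qed
  then show ?thesis unfolding open_circuit_def by blast
qed

lemma circ_set_restrict:
  assumes "ovl k (Ann m n x) \<subseteq> V"
  shows "circ_set k \<omega> m n x = circ_set k (\<lambda>e. e \<in> edges_in k V \<and> \<omega> e) m n x"
  unfolding circ_set_def using open_circuit_restrict assms by blast

lemma min_circuit_restrict:
  assumes "ovl k (Ann m n x) \<subseteq> V"
  shows "min_circuit k \<omega> m n x = min_circuit k (\<lambda>e. e \<in> edges_in k V \<and> \<omega> e) m n x"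
  unfolding min_circuit_def using circ_set_restrict[OF assms, of \<omega>] by simp

definition circ_fam :: "nat \<Rightarrow> int \<Rightarrow> int \<Rightarrow> int \<times> int \<Rightarrow> vtx list set" where
  "circ_fam k m n x = {c. is_circuit k c \<and> normalized c \<and> set c \<subseteq> ovl k (Ann m n x) \<and> surrounds c x}"

lemma circ_set_eq: "circ_set k (\<lambda>e. e \<in> S) m n x = {c \<in> circ_fam k m n x. cedges c \<subseteq> S}"
  unfolding circ_set_def circ_fam_def open_circuit_iff by auto

text \<open>Normal forms refer to the norm at the origin and are not preserved by translations,
  whereas \<open>loop\<close> is; existence of a circuit can thus be translated although the minimal
  circuit cannot.\<close>

lemma circ_set_nonempty_iff:
  assumes "0 \<le> m"
  shows "circ_set k (\<lambda>e. e \<in> S) m n x \<noteq> {} \<longleftrightarrow> (\<exists>c. loop k S m n x c)"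
proof
  assume "\<exists>c. loop k S m n x c"
  then obtain c where "loop k S m n x c" "normalized c" using loop_normalized[OF _ assms] by blast
  then show "circ_set k (\<lambda>e. e \<in> S) m n x \<noteq> {}" unfolding circ_set_eq circ_fam_def loop_def by blast
next
  assume "circ_set k (\<lambda>e. e \<in> S) m n x \<noteq> {}"
  then show "\<exists>c. loop k S m n x c" unfolding circ_set_eq circ_fam_def loop_def by blast
qed

lemma finite_ovl: "finite Z \<Longrightarrow> finite (ovl k Z)"
proof -
  assume "finite Z"
  then have "finite ((\<lambda>((a, b), c). (a, b, c)) ` (Z \<times> {0..int k}))" by simp
  moreover have "ovl k Z \<subseteq> (\<lambda>((a, b), c). (a, b, c)) ` (Z \<times> {0..int k})"
    by (force simp: ovl_def)
  ultimately show ?thesis by (rule rev_finite_subset)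
qed

lemma in_ovl_iff: "v \<in> ovl k Z \<longleftrightarrow> proj v \<in> Z \<and> v \<in> slab k"
  by (cases v) (auto simp: ovl_def proj_def slab_def)

lemma finite_Ann: "finite (Ann m n x)"
proof (rule finite_subset)
  show "Ann m n x \<subseteq> {fst x - n..fst x + n} \<times> {snd x - n..snd x + n}"
    unfolding Ann_def Box_def by (auto simp: abs_le_iff)
qed simp

lemma finite_circ_fam: "finite (circ_fam k m n x)"
proof (rule finite_subset)
  let ?V = "ovl k (Ann m n x)"
  have fin: "finite ?V" by (rule finite_ovl[OF finite_Ann])
  show "circ_fam k m n x \<subseteq> close_up ` {xs. set xs \<subseteq> ?V \<and> length xs \<le> card ?V}"
  proof
    fix c assume "c \<in> circ_fam k m n x"
    then have c: "is_circuit k c" "set c \<subseteq> ?V" unfolding circ_fam_def by auto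
    have "distinct (butlast c)" using c(1) unfolding is_circuit_iff by blast
    moreover have "set (butlast c) \<subseteq> ?V" using c(2) by (meson in_set_butlastD subset_iff)
    ultimately have "butlast c \<in> {xs. set xs \<subseteq> ?V \<and> length xs \<le> card ?V}"
      using card_mono[OF fin, of "set (butlast c)"] distinct_card[of "butlast c"] by simp
    then show "c \<in> close_up ` {xs. set xs \<subseteq> ?V \<and> length xs \<le> card ?V}"
      using circuit_close_up(1)[OF c(1)] by blast
  qed
  show "finite (close_up ` {xs. set xs \<subseteq> ?V \<and> length xs \<le> card ?V})"
    by (rule finite_imageI[OF finite_lists_length_le[OF fin]])
qed

text \<open>Translation invariance for local events: both probabilities are finite sums, matched by
  relabelling the edges.\<close>

lemma Pr_transport:
  assumes p: "0 \<le> p" "p \<le> 1" and V: "finite V"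
    and A: "\<And>\<omega>. A \<omega> \<longleftrightarrow> A (\<lambda>e. e \<in> edges_in k V \<and> \<omega> e)"
    and B: "\<And>\<omega>. B \<omega> \<longleftrightarrow> B (\<lambda>e. e \<in> edges_in k (shift d ` V) \<and> \<omega> e)"
    and AB: "\<And>S. B (\<lambda>e. e \<in> (`) (shift d) ` S) \<longleftrightarrow> A (\<lambda>e. e \<in> S)"
  shows "Pr k p B = Pr k p A"
proof -
  have sub: "edges_in k W \<subseteq> edges k" for W unfolding edges_in_def by blast
  have "Pr k p B = bern p (edges_in k (shift d ` V)) (\<lambda>S. B (\<lambda>e. e \<in> S))"
    by (rule Pr_eq_bern[where A = B and F = "edges_in k (shift d ` V)", OF p finite_edges_in sub])
      (use V B in auto)
  also have "\<dots> = bern p (edges_in k V) (\<lambda>S. B (\<lambda>e. e \<in> (`) (shift d) ` S))"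
    unfolding edges_in_shift[symmetric]
    by (rule bern_image) (rule injI, simp add: inj_image_eq_iff[OF inj_shift])
  also have "\<dots> = Pr k p A"
    unfolding AB
    by (rule Pr_eq_bern[where A = A and F = "edges_in k V", OF p finite_edges_in[OF V] sub, symmetric])
      (use A in auto)
  finally show ?thesis .
qed

lemma min_circuit_eqI:
  assumes "is_least circ_lex (circ_set k \<omega> m n x) c"
  shows "min_circuit k \<omega> m n x = set c"
proof -
  have "circ_set k \<omega> m n x \<noteq> {}" using assms unfolding is_least_def by blast
  moreover have "(THE c. is_least circ_lex (circ_set k \<omega> m n x) c) = c"
    by (rule the_equality) (auto intro: assms is_least_unique[OF _ assms circ_lex_order(1,2)])
  ultimately show ?thesis unfolding min_circuit_def is_least_def by simp
qed

lemma min_circuit_exists: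
  assumes "circ_set k \<omega> m n x \<noteq> {}"
  shows "\<exists>c\<in>circ_set k \<omega> m n x. min_circuit k \<omega> m n x = set c"
proof -
  have "circ_set k \<omega> m n x \<subseteq> circ_fam k m n x" unfolding circ_set_def circ_fam_def by blast
  then have "finite (circ_set k \<omega> m n x)" using finite_circ_fam finite_subset by blast
  moreover have "total_on (circ_set k \<omega> m n x) circ_lex"
    using circ_lex_order(3) unfolding total_on_def by blast
  ultimately obtain c where "is_least circ_lex (circ_set k \<omega> m n x) c"
    using is_least_exists[OF _ assms circ_lex_order(1)] by blast
  then show ?thesis using min_circuit_eqI unfolding is_least_def by blast
qed

lemma min_circuit_eq_empty_iff: "min_circuit k \<omega> m n x = {} \<longleftrightarrow> circ_set k \<omega> m n x = {}"
proof
  assume empty: "min_circuit k \<omega> m n x = {}"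
  show "circ_set k \<omega> m n x = {}"
  proof (rule ccontr)
    assume "circ_set k \<omega> m n x \<noteq> {}"
    then obtain c where c: "c \<in> circ_set k \<omega> m n x" "set c = {}"
      using min_circuit_exists empty by metis
    then have "is_circuit k c" unfolding circ_set_def by blast
    then show False using c(2) unfolding is_circuit_def by simp
  qed
qed (simp add: min_circuit_def)

lemma min_circuit_subset: "min_circuit k \<omega> m n x \<subseteq> ovl k (Ann m n x)"
proof (cases "circ_set k \<omega> m n x = {}")
  case False
  then obtain c where c: "c \<in> circ_set k \<omega> m n x" "min_circuit k \<omega> m n x = set c"
    using min_circuit_exists by blast
  then show ?thesis unfolding circ_set_def by blast
qed (simp add: min_circuit_def)

lemma circ_set_local:
  assumes "\<And>e c. c \<in> circ_fam k m n x \<Longrightarrow> e \<in> cedges c \<Longrightarrow> e \<in> S \<longleftrightarrow> e \<in> S'"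
  shows "circ_set k (\<lambda>e. e \<in> S) m n x = circ_set k (\<lambda>e. e \<in> S') m n x"
  unfolding circ_set_eq using assms by blast

lemma circ_fam_ovl: "c \<in> circ_fam k m n x \<Longrightarrow> v \<in> set c \<Longrightarrow> proj v \<in> Ann m n x \<and> v \<in> slab k"
  unfolding circ_fam_def using in_ovl_iff by blast

lemma in_rect_iff: "z \<in> rect a b c d \<longleftrightarrow> a \<le> fst z \<and> fst z \<le> b \<and> c \<le> snd z \<and> snd z \<le> d"
  unfolding rect_def by (cases z) auto

lemma ovl_mono: "Z \<subseteq> Z' \<Longrightarrow> ovl k Z \<subseteq> ovl k Z'"
  unfolding ovl_def by blast

lemma finite_rect: "finite (rect a b c d)"
  unfolding rect_def by simp

section \<open>Geometry of the two annuli and the strip\<close>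

locale two_annuli =
  fixes k :: nat and m n :: int
  assumes m: "0 \<le> m" and mn: "m \<le> n" and n: "0 < n"
begin

text \<open>The rectangle spanned by the two outer boxes. It contains the strip, so finitely many
  edges decide all events at once.\<close>

definition "region = ovl k (rect (- n) (4 * n) (- n) n)"
definition "strip = ovl k (rect 0 (3 * n) (- m) m)"
definition "left = ovl k (rect 0 0 (- m) m)"
definition "right = ovl k (rect (3 * n) (3 * n) (- m) m)"
definition "E = edges_in k region"
definition "fam1 = circ_fam k m n (0, 0)"
definition "fam2 = circ_fam k m n (3 * n, 0)"
definition "circuit1 S \<longleftrightarrow> circ_set k (\<lambda>e. e \<in> S) m n (0, 0) \<noteq> {}"
definition "circuit2 S \<longleftrightarrow> circ_set k (\<lambda>e. e \<in> S) m n (3 * n, 0) \<noteq> {}"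
text \<open>
  In the first gluing the empty target encodes that the second circuit is absent, so that its
  existence is kept by the surgery.
\<close>

definition "target1 S = (if circuit2 S then right else {})"
definition "target2 S = min_circuit k (\<lambda>e. e \<in> S) m n (0, 0)"

text \<open>With centres at distance \<open>3 * n\<close> the annuli share no column, so surgery
  near one circuit cannot touch the other. The ends of the strip lie in the inner boxes.\<close>

lemma Ann_fst:
  "z \<in> Ann m n (0, 0) \<Longrightarrow> fst z \<le> n" "z \<in> Ann m n (3 * n, 0) \<Longrightarrow> 2 * n \<le> fst z"
  "z \<in> Ann m n (3 * n, 0) \<Longrightarrow> z \<notin> rect (3 * n) (3 * n) (- m) m"
  "z \<in> Ann m n (0, 0) \<Longrightarrow> z \<notin> rect 0 0 (- m) m"
  using m n unfolding Ann_def Box_def by (auto simp: in_rect_iff abs_le_iff)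

lemma strip_region: "strip \<subseteq> region"
  unfolding strip_def region_def by (rule ovl_mono) (use mn n in \<open>auto simp: in_rect_iff\<close>)

lemma Ann_region: "ovl k (Ann m n (0, 0)) \<subseteq> region" "ovl k (Ann m n (3 * n, 0)) \<subseteq> region"
proof -
  have "Ann m n (0, 0) \<subseteq> rect (- n) (4 * n) (- n) n" "Ann m n (3 * n, 0) \<subseteq> rect (- n) (4 * n) (- n) n"
    using n by (auto simp: in_rect_iff Ann_def Box_def abs_le_iff)
  then show "ovl k (Ann m n (0, 0)) \<subseteq> region" "ovl k (Ann m n (3 * n, 0)) \<subseteq> region"
    unfolding region_def by (simp_all add: ovl_mono)
qed

lemma strip_slab: "strip \<subseteq> slab k"
  unfolding strip_def by (auto simp: in_ovl_iff)

lemma finite_E: "finite E" and E_edges: "E \<subseteq> edges k"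
  unfolding E_def region_def
  by (rule finite_edges_in[OF finite_ovl[OF finite_rect]]) (simp add: edges_in_def)

lemma strip_edges: "x \<in> strip \<Longrightarrow> y \<in> strip \<Longrightarrow> adj x y \<Longrightarrow> {x, y} \<in> E"
  unfolding E_def using edges_in_iff[of x y k region] strip_region strip_slab by blast

lemma fam_disjoint_column:
  assumes "v \<in> set c" "c \<in> fam1" "w \<in> set c'" "c' \<in> fam2"
  shows "proj v \<noteq> proj w"
proof -
  have "fst (proj v) \<le> n" "2 * n \<le> fst (proj w)"
    using assms circ_fam_ovl Ann_fst(1,2) unfolding fam1_def fam2_def by blast+
  then show ?thesis using n by auto
qed

lemma unaffected:
  assumes "\<And>e. e \<in> (S - S') \<union> (S' - S) \<Longrightarrow> \<exists>x\<in>e. proj x = proj y"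
    and "\<And>v. v \<in> set c \<Longrightarrow> proj v \<noteq> proj y" and "e \<in> cedges c"
  shows "e \<in> S \<longleftrightarrow> e \<in> S'"
proof (rule ccontr)
  assume "(e \<in> S) \<noteq> (e \<in> S')"
  then obtain x where "x \<in> e" "proj x = proj y" using assms(1)[of e] by blast
  moreover have "e \<subseteq> set c" using cedges_in[OF assms(3)] by blast
  ultimately show False using assms(2) by blast
qed

text \<open>Walks run from the right end of the strip, beyond the first annulus, into its inner box,
  and so share a column with each circuit. The circuits deciding \<open>target1\<close> have no
  vertex in that column.\<close>

lemma gluing1: "gluing k E strip left target1 fam1"
proof
  show "finite E" "E \<subseteq> edges k" "strip \<subseteq> slab k" by (rule finite_E E_edges strip_slab)+
  show "finite strip" unfolding strip_def by (rule finite_ovl[OF finite_rect])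
  show "finite fam1" unfolding fam1_def by (rule finite_circ_fam)
  show "y \<in> strip" if "x \<in> strip" "proj y = proj x" "y \<in> slab k" for x y
    using that unfolding strip_def in_ovl_iff by simp
  show "{x, y} \<in> E" if "x \<in> strip" "y \<in> strip" "adj x y" for x y using strip_edges that by blast
  show "set c \<subseteq> slab k" if "c \<in> fam1" for c using that circ_fam_ovl unfolding fam1_def by blast
  show "target1 S \<inter> left = {}" for S
    using n unfolding target1_def right_def left_def by (auto simp: in_ovl_iff in_rect_iff)
  show "proj x \<noteq> proj y" if "c \<in> fam1" "y \<in> set c" "x \<in> target1 S \<union> left" for c S x y
  proof -
    have y: "proj y \<in> Ann m n (0, 0)" using that circ_fam_ovl unfolding fam1_def by blast
    have "proj x \<in> rect (3 * n) (3 * n) (- m) m \<or> proj x \<in> rect 0 0 (- m) m"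
      using that(3) unfolding target1_def right_def left_def by (auto simp: in_ovl_iff split: if_splits)
    then show ?thesis using Ann_fst(1,4)[OF y] n by (auto simp: in_rect_iff)
  qed
  show "\<exists>x\<in>set ps. \<exists>y\<in>set c. proj x = proj y"
    if "c \<in> fam1" "walk S strip ps" "hd ps \<in> target1 S" "last ps \<in> left" for c S ps
  proof (rule circuit_meets_walk[of k c m n "(0, 0)" S strip])
    show "is_circuit k c" "set c \<subseteq> ovl k (Ann m n (0, 0))" "surrounds c (0, 0)"
      using that(1) unfolding fam1_def circ_fam_def by auto
    have "fst (proj (hd ps)) = 3 * n"
      using that(3) unfolding target1_def right_def by (auto simp: in_ovl_iff in_rect_iff split: if_splits)
    moreover have "fst (proj v) \<le> n" if "v \<in> set c" for v
      using that \<open>c \<in> fam1\<close> circ_fam_ovl Ann_fst(1) unfolding fam1_def by blast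
    ultimately show "(\<forall>v\<in>set c. fst (proj v) < fst (proj (hd ps))) \<or> (\<forall>v\<in>set c. fst (proj (hd ps)) < fst (proj v))"
      using n by force
    show "fst (proj (last ps)) = fst (0, 0)" "\<bar>snd (proj (last ps)) - snd (0, 0)\<bar> \<le> m"
      using that(4) unfolding left_def by (auto simp: in_ovl_iff in_rect_iff abs_le_iff)
  qed (rule that(2))
  show "target1 S = target1 S'"
    if "c \<in> fam1" "y \<in> set c" "\<And>e. e \<in> (S - S') \<union> (S' - S) \<Longrightarrow> \<exists>x\<in>e. proj x = proj y" for c y S S'
  proof -
    have "circ_set k (\<lambda>e. e \<in> S) m n (3 * n, 0) = circ_set k (\<lambda>e. e \<in> S') m n (3 * n, 0)"
    proof (rule circ_set_local)
      fix e c' assume c': "c' \<in> circ_fam k m n (3 * n, 0)" "e \<in> cedges c'"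
      show "e \<in> S \<longleftrightarrow> e \<in> S'"
        by (rule unaffected[OF that(3) _ c'(2)])
          (use fam_disjoint_column[OF that(2,1)] c'(1) in \<open>force simp: fam2_def\<close>)+
    qed
    then show ?thesis unfolding target1_def circuit2_def by simp
  qed
qed

text \<open>The mirror situation: walks come from the first circuit, to the left of the second
  annulus. Surgery in a column of the second annulus leaves all circuits of the first, and so the
  minimal one, unchanged.\<close>

lemma gluing2: "gluing k E strip right target2 fam2"
proof
  show "finite E" "E \<subseteq> edges k" "strip \<subseteq> slab k" by (rule finite_E E_edges strip_slab)+
  show "finite strip" unfolding strip_def by (rule finite_ovl[OF finite_rect])
  show "finite fam2" unfolding fam2_def by (rule finite_circ_fam)
  show "y \<in> strip" if "x \<in> strip" "proj y = proj x" "y \<in> slab k" for x y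
    using that unfolding strip_def in_ovl_iff by simp
  show "{x, y} \<in> E" if "x \<in> strip" "y \<in> strip" "adj x y" for x y using strip_edges that by blast
  show "set c \<subseteq> slab k" if "c \<in> fam2" for c using that circ_fam_ovl unfolding fam2_def by blast
  have t: "fst (proj x) \<le> n" if "x \<in> target2 S" for x S
    using that min_circuit_subset in_ovl_iff Ann_fst(1) unfolding target2_def by blast
  have r: "fst (proj x) = 3 * n" if "x \<in> right" for x
    using that unfolding right_def by (auto simp: in_ovl_iff in_rect_iff)
  show "target2 S \<inter> right = {}" for S using t[of _ S] r n by force
  show "proj x \<noteq> proj y" if "c \<in> fam2" "y \<in> set c" "x \<in> target2 S \<union> right" for c S x y
  proof -
    have y: "proj y \<in> Ann m n (3 * n, 0)" using that circ_fam_ovl unfolding fam2_def by blast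
    have "fst (proj x) \<le> n \<or> proj x \<in> rect (3 * n) (3 * n) (- m) m"
      using that(3) t[of x S] unfolding right_def by (auto simp: in_ovl_iff)
    then show ?thesis using Ann_fst(2,3)[OF y] n by auto
  qed
  show "\<exists>x\<in>set ps. \<exists>y\<in>set c. proj x = proj y"
    if "c \<in> fam2" "walk S strip ps" "hd ps \<in> target2 S" "last ps \<in> right" for c S ps
  proof (rule circuit_meets_walk[of k c m n "(3 * n, 0)" S strip])
    show "is_circuit k c" "set c \<subseteq> ovl k (Ann m n (3 * n, 0))" "surrounds c (3 * n, 0)"
      using that(1) unfolding fam2_def circ_fam_def by auto
    have "2 * n \<le> fst (proj v)" if "v \<in> set c" for v
      using that \<open>c \<in> fam2\<close> circ_fam_ovl Ann_fst(2) unfolding fam2_def by blast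
    then show "(\<forall>v\<in>set c. fst (proj v) < fst (proj (hd ps))) \<or> (\<forall>v\<in>set c. fst (proj (hd ps)) < fst (proj v))"
      using n t[OF that(3)] by force
    show "fst (proj (last ps)) = fst (3 * n, 0)" "\<bar>snd (proj (last ps)) - snd (3 * n, 0)\<bar> \<le> m"
      using that(4) unfolding right_def by (auto simp: in_ovl_iff in_rect_iff abs_le_iff)
  qed (rule that(2))
  show "target2 S = target2 S'"
    if "c \<in> fam2" "y \<in> set c" "\<And>e. e \<in> (S - S') \<union> (S' - S) \<Longrightarrow> \<exists>x\<in>e. proj x = proj y" for c y S S'
  proof -
    have "circ_set k (\<lambda>e. e \<in> S) m n (0, 0) = circ_set k (\<lambda>e. e \<in> S') m n (0, 0)"
    proof (rule circ_set_local)
      fix e c' assume c': "c' \<in> circ_fam k m n (0, 0)" "e \<in> cedges c'"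
      show "e \<in> S \<longleftrightarrow> e \<in> S'"
        by (rule unaffected[OF that(3) _ c'(2)])
          (use fam_disjoint_column[OF _ _ that(2,1)] c'(1) in \<open>force simp: fam1_def\<close>)+
    qed
    then show ?thesis unfolding target2_def min_circuit_def by simp
  qed
qed

definition "joined S \<longleftrightarrow> conn S strip (target2 S) (min_circuit k (\<lambda>e. e \<in> S) m n (3 * n, 0))"

lemma circuits_and_crossing:
  assumes \<epsilon>: "0 < \<epsilon>" "\<epsilon> \<le> p" "p \<le> 1 - \<epsilon>"
  defines "K \<equiv> 1 + 2 * (2 / \<epsilon>) ^ (6 * (k + 1))"
  shows "bern p E (\<lambda>S. circuit1 S \<and> circuit2 S \<and> conn S strip left right) \<le> K\<^sup>2 * bern p E joined"
proof -
  interpret g1: gluing k E strip left target1 fam1 by (rule gluing1)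
  interpret g2: gluing k E strip right target2 fam2 by (rule gluing2)
  have p: "0 \<le> p" "p \<le> 1" using \<epsilon> by auto
  have K: "0 \<le> K" using \<epsilon> unfolding K_def by simp
  have o1: "g1.opens S = circ_set k (\<lambda>e. e \<in> S) m n (0, 0)" for S
    unfolding g1.opens_def unfolding circ_set_eq fam1_def ..
  have o2: "g2.opens S = circ_set k (\<lambda>e. e \<in> S) m n (3 * n, 0)" for S
    unfolding g2.opens_def unfolding circ_set_eq fam2_def ..
  have c1: "g1.opens S \<noteq> {} \<Longrightarrow> set (g1.cmin S) = target2 S" for S
    using min_circuit_eqI g1.cmin unfolding target2_def o1 by metis
  have c2: "g2.opens S \<noteq> {} \<Longrightarrow> set (g2.cmin S) = min_circuit k (\<lambda>e. e \<in> S) m n (3 * n, 0)" for S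
    using min_circuit_eqI g2.cmin unfolding o2 by metis
  have "bern p E (\<lambda>S. circuit1 S \<and> circuit2 S \<and> conn S strip left right)
      \<le> bern p E (\<lambda>S. g1.opens S \<noteq> {} \<and> conn S strip (target1 S) left)"
    by (rule bern_mono[OF p]) (auto simp: o1 circuit1_def target1_def conn_commute[of _ strip left])
  also have "\<dots> \<le> K * bern p E g1.glued" unfolding K_def by (rule g1.gluing[OF \<epsilon>])
  \<comment> \<open>A nonempty target means that the second circuit exists. The path from the right
    end to the first circuit, read backwards, is the crossing needed for the second gluing.\<close>
  also have "bern p E g1.glued \<le> bern p E (\<lambda>S. g2.opens S \<noteq> {} \<and> conn S strip (target2 S) right)"
  proof (rule bern_mono[OF p])
    fix S assume "g1.glued S"
    then have g: "g1.opens S \<noteq> {}" "conn S strip (target1 S) (set (g1.cmin S))" unfolding g1.glued_def by auto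
    have "circuit2 S"
      using g(2) unfolding target1_def conn_def by (auto split: if_splits)
    then show "g2.opens S \<noteq> {} \<and> conn S strip (target2 S) right"
      using g(2) unfolding c1[OF g(1)] target1_def o2 circuit2_def
      by (simp add: conn_commute[of _ strip right])
  qed
  also have "\<dots> \<le> K * bern p E g2.glued" unfolding K_def by (rule g2.gluing[OF \<epsilon>])
  also have "bern p E g2.glued \<le> bern p E joined"
    by (rule bern_mono[OF p]) (metis g2.glued_def joined_def c2)
  finally show ?thesis using K by (simp add: power2_eq_square mult_left_mono mult.assoc)
qed

end

section \<open>Translation invariance of the crossing and circuit probabilities\<close>

lemma shift_image_eqI:
  assumes "\<And>v. v \<in> V \<Longrightarrow> shift d v \<in> W" "\<And>w. w \<in> W \<Longrightarrow> shift (- fst d, - snd d) w \<in> V"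
  shows "shift d ` V = W"
proof
  show "W \<subseteq> shift d ` V"
  proof
    fix w assume "w \<in> W"
    then have "shift d (shift (- fst d, - snd d) w) \<in> shift d ` V" using assms(2) by blast
    then show "w \<in> shift d ` V" unfolding shift_inverse .
  qed
qed (use assms(1) in blast)

lemma shift_rect:
  "shift d ` ovl k (rect a b c e) = ovl k (rect (a + fst d) (b + fst d) (c + snd d) (e + snd d))"
  by (rule shift_image_eqI) (auto simp: in_ovl_iff in_rect_iff shift_simps)

lemma shift_Ann:
  "shift d ` ovl k (Ann m n x) = ovl k (Ann m n (fst x + fst d, snd x + snd d))"
  by (rule shift_image_eqI) (auto simp: in_ovl_iff Ann_def Box_def shift_simps)

lemma crossing_prob_shift:
  assumes "0 \<le> p" "p \<le> 1"
  shows "crossing_prob k p l (2 * m) = Pr k p (\<lambda>\<omega>. connects k \<omega> (ovl k (rect 0 l (- m) m))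
    (ovl k (rect 0 0 (- m) m)) (ovl k (rect l l (- m) m)))"
proof -
  let ?V = "ovl k (rect 0 l 0 (2 * m))"
  have V: "shift (0, - m) ` ovl k (rect a b 0 (2 * m)) = ovl k (rect a b (- m) m)" for a b
    unfolding shift_rect by simp
  have slab: "ovl k Z \<subseteq> slab k" for Z using in_ovl_iff by blast
  show ?thesis
    unfolding crossing_prob_def
  proof (rule Pr_transport[symmetric, OF assms, where V = ?V and d = "(0, - m)"])
    fix S
    show "connects k (\<lambda>e. e \<in> (`) (shift (0, - m)) ` S) (ovl k (rect 0 l (- m) m))
        (ovl k (rect 0 0 (- m) m)) (ovl k (rect l l (- m) m)) \<longleftrightarrow>
      connects k (\<lambda>e. e \<in> S) ?V (ovl k (rect 0 0 0 (2 * m))) (ovl k (rect l l 0 (2 * m)))"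
      using conn_shift[of "(0, - m)" S ?V "ovl k (rect 0 0 0 (2 * m))" "ovl k (rect l l 0 (2 * m))"]
      unfolding connects_iff_conn[OF slab] V .
  next
    show "finite ?V" by (rule finite_ovl[OF finite_rect])
  next
    fix \<omega>
    show "connects k \<omega> ?V (ovl k (rect 0 0 0 (2 * m))) (ovl k (rect l l 0 (2 * m))) \<longleftrightarrow>
      connects k (\<lambda>e. e \<in> edges_in k ?V \<and> \<omega> e) ?V (ovl k (rect 0 0 0 (2 * m))) (ovl k (rect l l 0 (2 * m)))"
      by (rule connects_restrict[OF subset_refl])
    show "connects k \<omega> (ovl k (rect 0 l (- m) m)) (ovl k (rect 0 0 (- m) m)) (ovl k (rect l l (- m) m)) \<longleftrightarrow>
      connects k (\<lambda>e. e \<in> edges_in k (shift (0, - m) ` ?V) \<and> \<omega> e) (ovl k (rect 0 l (- m) m))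
        (ovl k (rect 0 0 (- m) m)) (ovl k (rect l l (- m) m))"
      unfolding V by (rule connects_restrict[OF subset_refl])
  qed
qed

lemma circuit_prob_shift:
  assumes "0 \<le> p" "p \<le> 1" "0 \<le> m"
  shows "Pr k p (\<lambda>\<omega>. min_circuit k \<omega> m n d \<noteq> {}) = Pr k p (\<lambda>\<omega>. min_circuit k \<omega> m n (0, 0) \<noteq> {})"
proof (rule Pr_transport[OF assms(1,2), where V = "ovl k (Ann m n (0, 0))" and d = d])
  show "finite (ovl k (Ann m n (0, 0)))" by (rule finite_ovl[OF finite_Ann])
  show "min_circuit k \<omega> m n (0, 0) \<noteq> {} \<longleftrightarrow>
      min_circuit k (\<lambda>e. e \<in> edges_in k (ovl k (Ann m n (0, 0))) \<and> \<omega> e) m n (0, 0) \<noteq> {}" for \<omega>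
    using min_circuit_restrict[OF subset_refl, of k \<omega>] by simp
  show "min_circuit k \<omega> m n d \<noteq> {} \<longleftrightarrow>
      min_circuit k (\<lambda>e. e \<in> edges_in k (shift d ` ovl k (Ann m n (0, 0))) \<and> \<omega> e) m n d \<noteq> {}" for \<omega>
    using min_circuit_restrict[of k m n d "shift d ` ovl k (Ann m n (0, 0))" \<omega>] by (simp add: shift_Ann)
  show "min_circuit k (\<lambda>e. e \<in> (`) (shift d) ` S) m n d \<noteq> {} \<longleftrightarrow>
      min_circuit k (\<lambda>e. e \<in> S) m n (0, 0) \<noteq> {}" for S
    using loop_shift_iff[of k d S m n "(0, 0)"]
    unfolding min_circuit_eq_empty_iff circ_set_nonempty_iff[OF assms(3)] by simp
qed

lemma circ_set_nonempty_mono: "mono (\<lambda>S. circ_set k (\<lambda>e. e \<in> S) m n x \<noteq> {})"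
  unfolding circ_set_eq mono_def by (auto dest: subset_trans)

lemma conn_mono: "mono (\<lambda>S. conn S X A B)"
proof (intro monoI le_boolI)
  fix S S' assume "S \<subseteq> S'" "conn S X A B"
  then show "conn S' X A B" using walk_mono[of S X _ S' X] unfolding conn_def by blast
qed

theorem mainTheorem6:
  fixes k :: nat and \<epsilon> :: real
  assumes "k \<ge> 1" and "\<epsilon> > 0"
  shows "\<exists>h. classH h \<and>
    (\<forall>p \<in> {\<epsilon>..1-\<epsilon>}. \<forall>m n :: int. 3 \<le> m \<longrightarrow> m \<le> n \<longrightarrow>
       Pr k p (\<lambda>\<omega>. connects k \<omega> (ovl k (rect 0 (3*n) (-m) m))
                 (min_circuit k \<omega> m n (0,0)) (min_circuit k \<omega> m n (3*n,0)))
       \<ge> h (crossing_prob k p (3*n) (2*m) *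
             (Pr k p (\<lambda>\<omega>. min_circuit k \<omega> m n (0,0) \<noteq> {}))^2))"
proof -
  \<comment> \<open>The loss in one gluing. It is at least 1, so dividing by
    \<open>K\<^sup>2\<close> maps the unit interval into itself.\<close>
  define K where "K = 1 + 2 * (2 / \<epsilon>) ^ (6 * (k + 1))"
  have K: "1 \<le> K\<^sup>2" using assms(2) unfolding K_def by (simp add: one_le_power)
  define h where "h x = x / K\<^sup>2" for x :: real
  have "classH h"
    unfolding classH_def
  proof (intro conjI)
    show "continuous_on {0..1} h" unfolding h_def by (intro continuous_intros) (use K in auto)
    show "strict_mono_on {0..1} h"
      unfolding h_def by (intro strict_mono_onI divide_strict_right_mono) (use K in auto)
    show "h ` {0..1} \<subseteq> {0..1}" unfolding h_def using K by (auto simp: divide_le_eq)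
  qed
  moreover have "h (crossing_prob k p (3*n) (2*m) * (Pr k p (\<lambda>\<omega>. min_circuit k \<omega> m n (0,0) \<noteq> {}))^2)
      \<le> Pr k p (\<lambda>\<omega>. connects k \<omega> (ovl k (rect 0 (3*n) (-m) m))
                 (min_circuit k \<omega> m n (0,0)) (min_circuit k \<omega> m n (3*n,0)))"
    if p: "p \<in> {\<epsilon>..1-\<epsilon>}" and mn: "3 \<le> m" "m \<le> n" for p and m n :: int
  proof -
    have \<epsilon>: "0 < \<epsilon>" "\<epsilon> \<le> p" "p \<le> 1 - \<epsilon>" using p assms(2) by auto
    then have p01: "0 \<le> p" "p \<le> 1" by auto
    interpret two_annuli k m n using mn by unfold_locales auto
    have slab: "ovl k Z \<subseteq> slab k" for Z using in_ovl_iff by blast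
    have circ: "Pr k p (\<lambda>\<omega>. min_circuit k \<omega> m n x \<noteq> {}) = bern p E (\<lambda>S. circ_set k (\<lambda>e. e \<in> S) m n x \<noteq> {})"
      if "ovl k (Ann m n x) \<subseteq> region" for x
    proof -
      have "Pr k p (\<lambda>\<omega>. min_circuit k \<omega> m n x \<noteq> {}) = bern p E (\<lambda>S. min_circuit k (\<lambda>e. e \<in> S) m n x \<noteq> {})"
        by (rule Pr_eq_bern[OF p01 finite_E E_edges])
          (unfold E_def min_circuit_restrict[OF that, symmetric], rule refl)
      then show ?thesis unfolding min_circuit_eq_empty_iff .
    qed
    have cross: "crossing_prob k p (3 * n) (2 * m) = bern p E (\<lambda>S. conn S strip left right)"
    proof -
      have "crossing_prob k p (3 * n) (2 * m) = Pr k p (\<lambda>\<omega>. connects k \<omega> strip left right)"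
        unfolding crossing_prob_shift[OF p01] strip_def left_def right_def ..
      also have "\<dots> = bern p E (\<lambda>S. connects k (\<lambda>e. e \<in> S) strip left right)"
        by (rule Pr_eq_bern[OF p01 finite_E E_edges])
          (unfold E_def connects_restrict[OF strip_region, symmetric], rule refl)
      finally show ?thesis unfolding connects_iff_conn[OF strip_slab] .
    qed
    have joined: "Pr k p (\<lambda>\<omega>. connects k \<omega> strip
          (min_circuit k \<omega> m n (0,0)) (min_circuit k \<omega> m n (3*n,0))) = bern p E joined"
    proof -
      have "Pr k p (\<lambda>\<omega>. connects k \<omega> strip (min_circuit k \<omega> m n (0,0)) (min_circuit k \<omega> m n (3*n,0)))
        = bern p E (\<lambda>S. connects k (\<lambda>e. e \<in> S) strip (min_circuit k (\<lambda>e. e \<in> S) m n (0,0))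
            (min_circuit k (\<lambda>e. e \<in> S) m n (3*n,0)))"
        by (rule Pr_eq_bern[OF p01 finite_E E_edges])
          (unfold E_def connects_restrict[OF strip_region, symmetric]
            min_circuit_restrict[OF Ann_region(1), symmetric] min_circuit_restrict[OF Ann_region(2), symmetric],
            rule refl)
      then show ?thesis unfolding connects_iff_conn[OF strip_slab] joined_def target2_def .
    qed
    let ?A = "\<lambda>S. conn S strip left right"
    \<comment> \<open>Harris' inequality is applied to existence of the circuits and to the crossing
      only; for the connection of minimal circuits, opening an edge may change the circuits
      themselves.\<close>
    have m1: "mono circuit1" "mono circuit2" "mono ?A"
      unfolding circuit1_def circuit2_def by (rule circ_set_nonempty_mono conn_mono)+
    have m2: "mono (\<lambda>S. circuit2 S \<and> ?A S)" using m1(2,3) unfolding mono_def by auto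
    have "bern p E circuit1 * (bern p E circuit2 * bern p E ?A) \<le> bern p E circuit1 * bern p E (\<lambda>S. circuit2 S \<and> ?A S)"
      by (intro mult_left_mono harris[OF finite_E p01 m1(2,3)] bern_nonneg p01)
    also have "\<dots> \<le> bern p E (\<lambda>S. circuit1 S \<and> circuit2 S \<and> ?A S)"
      by (rule harris[OF finite_E p01 m1(1) m2])
    also have "\<dots> \<le> K\<^sup>2 * bern p E joined"
      unfolding K_def by (rule circuits_and_crossing[OF \<epsilon>])
    finally have main: "bern p E circuit1 * (bern p E circuit2 * bern p E ?A) \<le> K\<^sup>2 * bern p E joined" .
    have c1: "bern p E circuit1 = Pr k p (\<lambda>\<omega>. min_circuit k \<omega> m n (0, 0) \<noteq> {})"
      unfolding circ[OF Ann_region(1)] circuit1_def ..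
    have c2: "bern p E circuit2 = Pr k p (\<lambda>\<omega>. min_circuit k \<omega> m n (0, 0) \<noteq> {})"
      unfolding circuit_prob_shift[OF p01 m, of k n "(3 * n, 0)", symmetric] circ[OF Ann_region(2)] circuit2_def ..
    from main K show ?thesis
      unfolding c1 c2 cross[symmetric] joined[symmetric, unfolded strip_def] h_def
      by (simp add: divide_le_eq power2_eq_square mult_ac)
  qed
  ultimately show ?thesis by blast
qed

end
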